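(* Let $\mathcal{T}\in\mathbb{R}^{n_1\times\cdots\times n_d}$ satisfy $\mathcal{T}=(U_1^{\#},\dots,U_d^{\#}).\mathcal{G}^{\#}$ where $U_i^{\#}\in\mathbb{R}^{n_i\times r_i}_+$ with $(U_i^{\#})^\top e=e$ for $i\in[d]$ and $\mathcal{G}^{\#}\in\mathbb{R}^{r_1\times\cdots\times r_d}$. Let $[d]=\mathcal{I}\sqcup\mathcal{J}\sqcup\mathcal{K}$ be a partition into disjoint non-empty subsets such that: (i) $\bigotimes_{i\in S}U_i^{\#}$ satisfies the SSC for $S\in\{\mathcal{I},\mathcal{J},\mathcal{K}\}$; (ii) there is a tuple $i^0_{\mathcal{J}}$ such that $\operatorname{rank}(\mathcal{T}^{(\mathcal{J})}_{i^0_{\mathcal{J}}})=\prod_{i\in\mathcal{I}}r_i=\prod_{k\in\mathcal{K}}r_k=r$; (iii) $\operatorname{rank}(\mathcal{G}^{\#}_{\mathcal{J}})=\prod_{j\in\mathcal{J}}r_j\le r^2$. Write $n_S=\prod_{i\in S}n_i$ and $r_S=\prod_{i\in S}r_i$. Let $(U_1^*,\dots,U_d^*,\mathcal{G}^* )$ be any output of the following procedure: 1. Let $(U_{\mathcal{I}}^*,U_{\mathcal{K}}^*,S_1^* )$ be an optimal solution of $$\min_{U_{\mathcal{I}}\in\mathbb{R}^{n_{\mathcal{I}}\times r},\,U_{\mathcal{K}}\in\mathbb{R}^{n_{\mathcal{K}}\times r},\,S_1\in\mathbb{R}^{r\times r}}|\det(S_1)|\ \text{ such that }\ \mathcal{T}^{(\mathcal{J})}_{i^0_{\mathcal{J}}}=U_{\mathcal{I}}S_1U_{\mathcal{K}}^\top,\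 U_S^\top e=e,\ U_S\ge0\text{ for }S\in\{\mathcal{I},\mathcal{K}\}.$$ 2. Let $S^*\in\mathbb{R}^{r^2\times n_{\mathcal{J}}}$ be the matrix whose $i_{\mathcal{J}}$-th column is $\operatorname{vec}\big((U_{\mathcal{I}}^* )^\dagger\mathcal{T}^{(\mathcal{J})}_{i_{\mathcal{J}}}((U_{\mathcal{K}}^* )^\top)^\dagger\big)$, for every tuple $i_{\mathcal{J}}$, and let $(G^*,U_{\mathcal{J}}^* )$ be an optimal solution of $$\min_{G\in\mathbb{R}^{r^2\times r_{\mathcal{J}}},\,U_{\mathcal{J}}\in\mathbb{R}^{n_{\mathcal{J}}\times r_{\mathcal{J}}}}\det(G^\top G)\ \text{ such that }\ S^*=GU_{\mathcal{J}}^\top,\ U_{\mathcal{J}}^\top e=e,\ U_{\mathcal{J}}\ge0.$$ 3. For $S\in\{\mathcal{I},\mathcal{J},\mathcal{K}\}$, let $\Pi_S^*$ be a permutation matrix such that $U_S^*\Pi_S^*=\bigotimes_{j\in S}U_j^*$ for some $U_j^*\in\mathbb{R}^{n_j\times r_j}$ with $(U_j^* )^\top e=e$ for all $j\in S$. 4. Let $\mathcal{G}^*\in\mathbb{R}^{r_1\times\cdots\times r_d}$ be the tensor whose unfolding along $\mathcal{J}$ is $\mathcal{G}^*_{\mathcal{J}}=(\Pi_{\mathcal{I}}^*\otimes\Pi_{\mathcal{K}}^* )^\top G^*\Pi_{\mathcal{J}}^*$. Then there exist permutation matrices $\Pi_i$ for $i\in[d]$ such that $U_i^*=U_i^{\#}\Pi_i$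 for all $i\in[d]$ and $\mathcal{G}^*=(\Pi_1^\top,\dots,\Pi_d^\top).\mathcal{G}^{\#}$.
   Context: $[d]=\{1,\dots,d\}$, $e$ is the all-ones vector of appropriate dimension, $e_k$ the $k$-th standard basis vector, $\ge$ is entrywise, and $U^\dagger$ denotes the Moore-Penrose inverse. For $U_i\in\mathbb{R}^{n_i\times r_i}$ and $\mathcal{G}\in\mathbb{R}^{r_1\times\cdots\times r_d}$, $(U_1,\dots,U_d).\mathcal{G}\in\mathbb{R}^{n_1\times\cdots\times n_d}$ is the tensor with entries $\sum_{i_1,\dots,i_d}\big(\prod_{t=1}^d(U_t)_{j_t,i_t}\big)\mathcal{G}_{i_1,\dots,i_d}$. For $S\subseteq[d]$ and a tuple $(i_1,\dots,i_d)$, $i_S$ denotes the subtuple $(i_j)_{j\in S}$. Given the partition $\mathcal{I}\sqcup\mathcal{J}\sqcup\mathcal{K}$, the $(\mathcal{J},\mathcal{K})$-slices of $\mathcal{T}$ are the $\prod_{i\in\mathcal{I}}n_i\times\prod_{k\in\mathcal{K}}n_k$ matrices $\mathcal{T}^{(\mathcal{J})}_{i_{\mathcal{J}}}$ with $(i_{\mathcal{I}},i_{\mathcal{K}})$ entry $\mathcal{T}_{i_1,\dots,i_d}$. The unfolding $\mathcal{G}_{\mathcal{J}}$ of $\mathcal{G}$ along $\mathcal{J}$ is the $\prod_{j\notin\mathcal{J}}r_j\times\prod_{j\in\mathcal{J}}r_j$ matrix with entry $\mathcal{G}_{i_1,\dots,i_d}$ at row $(i_{\mathcal{I}},i_{\mathcal{K}})$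 and column $i_{\mathcal{J}}$. The Kronecker product $\bigotimes_{j\in S}U_j$ is the matrix with $(k_S,i_S)$ entry $\prod_{j\in S}(U_j)_{k_j,i_j}$; likewise $(A\otimes B)_{(k,l),(i,j)}=A_{k,i}B_{l,j}$; and $\operatorname{vec}$ of a matrix $M$ is the vector with entry $M_{a,b}$ at index $(a,b)$. All rows and columns are indexed by tuples, with one fixed linear ordering of tuples used consistently throughout. For $A\in\mathbb{R}^{m\times n}$, $\operatorname{cone}(A)=\{Ay : y\in\mathbb{R}^n, y\ge 0\}$ and $\operatorname{cone}^*(A)=\{y\in\mathbb{R}^m : A^\top y\ge 0\}$. A matrix $H\in\mathbb{R}^{n\times r}_+$ with $r\ge2$ satisfies the sufficiently scattered condition (SSC) if: (SSC1) $\{x\in\mathbb{R}^r_+ : e^\top x\ge\sqrt{r-1}\,\|x\|_2\}\subseteq\operatorname{cone}(H^\top)$; and (SSC2) $\operatorname{cone}^*(H^\top)\cap\operatorname{bd}(\mathcal{C}^* )=\{\lambda e_k : \lambda\ge0,\ k\in\{1,\dots,r\}\}$, where $\mathcal{C}^*=\{x\in\mathbb{R}^r : e^\top x\ge\|x\|_2\}$ and $\operatorname{bd}$ denotes the boundary. *)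

theory Defs
  imports
    "HOL-Analysis.Abstract_Metric_Spaces"
    "HOL-Analysis.L2_Norm"
    "Jordan_Normal_Form.DL_Rank"
    "Jordan_Normal_Form.Determinant"
begin

unbundle no vec_syntax and no inner_syntax

text \<open>Matrices and vectors are those of \<open>Jordan_Normal_Form\<close>, so rows and columns are numbered
  from 0.  The order relation on them is the entrywise one and it includes equality of dimensions.\<close>

definition ones :: "nat \<Rightarrow> real vec" where
  "ones n = vec n (\<lambda>_. 1)"

definition col_stochastic :: "real mat \<Rightarrow> bool" where
  "col_stochastic U \<longleftrightarrow> U\<^sup>T *\<^sub>v ones (dim_row U) = ones (dim_col U)"

definition nonneg_mat :: "real mat \<Rightarrow> bool" where
  "nonneg_mat U \<longleftrightarrow> 0\<^sub>m (dim_row U) (dim_col U) \<le> U"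

definition mat_rank :: "real mat \<Rightarrow> nat" where
  "mat_rank A = vec_space.rank (dim_row A) A"

definition permutation_mat :: "nat \<Rightarrow> real mat \<Rightarrow> bool" where
  "permutation_mat n P \<longleftrightarrow>
     (\<exists>p. p permutes {..<n} \<and> P = mat n n (\<lambda>(i, j). if i = p j then 1 else 0))"

text \<open>The Moore--Penrose inverse is the unique solution of the four Penrose equations.\<close>

definition penrose_inverse :: "real mat \<Rightarrow> real mat \<Rightarrow> bool" where
  "penrose_inverse A X \<longleftrightarrow> X \<in> carrier_mat (dim_col A) (dim_row A) \<and>
     A * X * A = A \<and> X * A * X = X \<and> (A * X)\<^sup>T = A * X \<and> (X * A)\<^sup>T = X * A"

definition mp_inverse :: "real mat \<Rightarrow> real mat" where
  "mp_inverse A = (THE X. penrose_inverse A X)"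

definition mat_cone :: "real mat \<Rightarrow> real vec set" where
  "mat_cone A = {A *\<^sub>v y | y. y \<in> carrier_vec (dim_col A) \<and> 0\<^sub>v (dim_col A) \<le> y}"

definition dual_cone :: "real mat \<Rightarrow> real vec set" where
  "dual_cone A = {y \<in> carrier_vec (dim_row A). 0\<^sub>v (dim_col A) \<le> A\<^sup>T *\<^sub>v y}"

definition vec_norm2 :: "real vec \<Rightarrow> real" where
  "vec_norm2 x = L2_set (\<lambda>i. x $ i) {..<dim_vec x}"

text \<open>The library has no topology on variable-dimension vectors, so the boundary is taken
  in the metric topology given by the Euclidean distance.  The distance has the dimension as an
  argument because \<open>Metric_space\<close> demands symmetry even outside the carrier.\<close>

definition vec_dist :: "nat \<Rightarrow> real vec \<Rightarrow> real vec \<Rightarrow> real" where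
  "vec_dist n x y = L2_set (\<lambda>i. x $ i - y $ i) {..<n}"

lemma Metric_space_vec: "Metric_space (carrier_vec n) (vec_dist n)"
proof
  fix x y z :: "real vec"
  show "0 \<le> vec_dist n x y"
    by (simp add: vec_dist_def)
  show "vec_dist n x y = vec_dist n y x"
    by (simp add: vec_dist_def L2_set_def power2_commute)
  show "vec_dist n x y = 0 \<longleftrightarrow> x = y" if "x \<in> carrier_vec n" "y \<in> carrier_vec n"
    using that by (auto simp: vec_dist_def L2_set_eq_0_iff)
  have "vec_dist n x z = L2_set (\<lambda>i. (x $ i - y $ i) + (y $ i - z $ i)) {..<n}"
    by (simp add: vec_dist_def)
  also have "\<dots> \<le> vec_dist n x y + vec_dist n y z"
    unfolding vec_dist_def by (rule L2_set_triangle_ineq)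
  finally show "vec_dist n x z \<le> vec_dist n x y + vec_dist n y z" .
qed

lemma vec_dist_eq_norm:
  "x \<in> carrier_vec n \<Longrightarrow> y \<in> carrier_vec n \<Longrightarrow> vec_dist n x y = vec_norm2 (x - y)"
  by (auto simp: vec_dist_def vec_norm2_def intro!: L2_set_cong)

definition vec_topology :: "nat \<Rightarrow> real vec topology" where
  "vec_topology n = Metric_space.mtopology (carrier_vec n) (vec_dist n)"

definition C_star :: "nat \<Rightarrow> real vec set" where
  "C_star r = {x \<in> carrier_vec r. vec_norm2 x \<le> ones r \<bullet> x}"

definition SSC1 :: "real mat \<Rightarrow> bool" where
  "SSC1 H \<longleftrightarrow> (let r = dim_col H in
     {x \<in> carrier_vec r. 0\<^sub>v r \<le> x \<and> sqrt (real r - 1) * vec_norm2 x \<le> ones r \<bullet> x}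
       \<subseteq> mat_cone (H\<^sup>T))"

definition SSC2 :: "real mat \<Rightarrow> bool" where
  "SSC2 H \<longleftrightarrow> (let r = dim_col H in
     dual_cone (H\<^sup>T) \<inter> (vec_topology r frontier_of C_star r)
       = {c \<cdot>\<^sub>v unit_vec r k | c k. 0 \<le> c \<and> k < r})"

definition SSC :: "real mat \<Rightarrow> bool" where
  "SSC H \<longleftrightarrow> 2 \<le> dim_col H \<and> nonneg_mat H \<and> SSC1 H \<and> SSC2 H"

text \<open>Modes are natural numbers, and the tuples \<open>i\<^sub>S\<close> with \<open>i\<^sub>j < n j\<close> are extensional functions
  on \<open>S\<close>.  A tensor is an extensional function on tuples, so that equality of tensors is equality of
  all entries.\<close>

definition tuples :: "(nat \<Rightarrow> nat) \<Rightarrow> nat set \<Rightarrow> (nat \<Rightarrow> nat) set" where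
  "tuples n S = (\<Pi>\<^sub>E j\<in>S. {..<n j})"

definition tensors :: "nat \<Rightarrow> (nat \<Rightarrow> nat) \<Rightarrow> ((nat \<Rightarrow> nat) \<Rightarrow> real) set" where
  "tensors d n = tuples n {1..d} \<rightarrow>\<^sub>E UNIV"

text \<open>The dimensions of the two tensors are read off the matrices.\<close>

definition multilinear_mult ::
  "nat \<Rightarrow> (nat \<Rightarrow> real mat) \<Rightarrow> ((nat \<Rightarrow> nat) \<Rightarrow> real) \<Rightarrow> ((nat \<Rightarrow> nat) \<Rightarrow> real)" where
  "multilinear_mult d U G =
     (\<lambda>j\<in>tuples (\<lambda>t. dim_row (U t)) {1..d}.
        \<Sum>i\<in>tuples (\<lambda>t. dim_col (U t)) {1..d}. (\<Prod>t=1..d. U t $$ (j t, i t)) * G i)"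

text \<open>The tuple at position \<open>a\<close> in the lexicographic enumeration of \<open>tuples n S\<close>, in which the
  smallest mode is the most significant one: \<open>a = \<Sum>j\<in>S. i\<^sub>j * (\<Prod>k\<in>S, k > j. n k)\<close>.\<close>

definition lex_tuple :: "(nat \<Rightarrow> nat) \<Rightarrow> nat set \<Rightarrow> nat \<Rightarrow> (nat \<Rightarrow> nat)" where
  "lex_tuple n S a = (\<lambda>j\<in>S. a div prod n {k \<in> S. j < k} mod n j)"

lemma lex_tuple_insert:
  assumes "finite S" "\<And>j. j \<in> S \<Longrightarrow> j < m"
  shows "lex_tuple n (insert m S) a = (lex_tuple n S (a div n m))(m := a mod n m)"
proof
  fix j
  have "m \<notin> S" using assms(2) by blast
  have "{k \<in> insert m S. m < k} = {}" using assms(2) by (auto dest: order.asym)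
  then have *: "prod n {k \<in> insert m S. m < k} = 1" by (simp only: prod.empty)
  have "{k \<in> insert m S. j < k} = insert m {k \<in> S. j < k}" if "j \<in> S"
    using that assms(2) by auto
  then have "prod n {k \<in> insert m S. j < k} = n m * prod n {k \<in> S. j < k}" if "j \<in> S"
    using that assms \<open>m \<notin> S\<close> by simp
  then show "lex_tuple n (insert m S) a j = ((lex_tuple n S (a div n m))(m := a mod n m)) j"
    unfolding lex_tuple_def restrict_def fun_upd_def using * \<open>m \<notin> S\<close>
    by (cases "j = m"; cases "j \<in> S") (simp_all only: insertI1 insert_iff if_True if_False
      div_by_1 div_mult2_eq simp_thms)
qed

lemma lex_tuple_inj:
  assumes "finite S"
  shows "inj_on (lex_tuple n S) {..<prod n S}"
  using assms
proof (induction S rule: finite_linorder_max_induct)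
  case empty
  then show ?case by (auto simp: inj_on_def)
next
  case (insert m S)
  have m: "m \<notin> S" using insert.hyps by blast
  show ?case
  proof (rule inj_onI)
    fix a b
    assume a: "a \<in> {..<prod n (insert m S)}" and b: "b \<in> {..<prod n (insert m S)}"
      and eq: "lex_tuple n (insert m S) a = lex_tuple n (insert m S) b"
    have eq': "(lex_tuple n S (a div n m))(m := a mod n m) = (lex_tuple n S (b div n m))(m := b mod n m)"
      using eq insert.hyps by (simp add: lex_tuple_insert)
    have "a mod n m = b mod n m"
      using fun_cong[OF eq', of m] by simp
    moreover have "lex_tuple n S (a div n m) = lex_tuple n S (b div n m)"
    proof
      fix j
      show "lex_tuple n S (a div n m) j = lex_tuple n S (b div n m) j"
        using fun_cong[OF eq', of j] m by (cases "j = m") (auto simp: lex_tuple_def)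
    qed
    moreover have "a div n m < prod n S" "b div n m < prod n S"
      using a b m insert.hyps by (auto simp: less_mult_imp_div_less mult.commute)
    ultimately have "a div n m = b div n m"
      using insert.IH by (auto dest: inj_onD)
    with \<open>a mod n m = b mod n m\<close> show "a = b"
      by (metis div_mult_mod_eq)
  qed
qed

lemma lex_tuple_bij:
  assumes "finite S"
  shows "bij_betw (lex_tuple n S) {..<prod n S} (tuples n S)"
proof -
  have "lex_tuple n S ` {..<prod n S} \<subseteq> tuples n S"
  proof
    fix x assume "x \<in> lex_tuple n S ` {..<prod n S}"
    then obtain a where a: "a < prod n S" "x = lex_tuple n S a" by auto
    then have "\<And>j. j \<in> S \<Longrightarrow> n j > 0"
      using assms by (metis not_gr_zero not_less_zero prod_zero_iff)
    with a show "x \<in> tuples n S" by (auto simp: tuples_def lex_tuple_def)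
  qed
  moreover have "card (tuples n S) = prod n S" "finite (tuples n S)"
    using assms by (simp_all add: tuples_def card_PiE finite_PiE)
  ultimately show ?thesis
    using lex_tuple_inj[OF assms, of n]
    by (metis bij_betw_def card_image card_lessThan card_subset_eq)
qed

text \<open>The tuple on \<open>I \<union> J \<union> K\<close> whose subtuples are \<open>x\<close>, \<open>y\<close> and \<open>z\<close>, where \<open>z\<close> is extensional
  on \<open>K\<close>.\<close>

definition join :: "nat set \<Rightarrow> nat set \<Rightarrow> (nat \<Rightarrow> nat) \<Rightarrow> (nat \<Rightarrow> nat) \<Rightarrow> (nat \<Rightarrow> nat) \<Rightarrow> nat \<Rightarrow> nat"
  where "join I J x y z = (\<lambda>t. if t \<in> I then x t else if t \<in> J then y t else z t)"

definition slice :: "(nat \<Rightarrow> nat) \<Rightarrow> nat set \<Rightarrow> nat set \<Rightarrow> nat set \<Rightarrow>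
    ((nat \<Rightarrow> nat) \<Rightarrow> real) \<Rightarrow> (nat \<Rightarrow> nat) \<Rightarrow> real mat" where
  "slice n I J K T j = mat (prod n I) (prod n K)
     (\<lambda>(a, b). T (join I J (lex_tuple n I a) j (lex_tuple n K b)))"

text \<open>Here and below a pair of indices \<open>(a, b)\<close> with \<open>b < q\<close> has position \<open>a * q + b\<close>.\<close>

definition unfolding_mat :: "(nat \<Rightarrow> nat) \<Rightarrow> nat set \<Rightarrow> nat set \<Rightarrow> nat set \<Rightarrow>
    ((nat \<Rightarrow> nat) \<Rightarrow> real) \<Rightarrow> real mat" where
  "unfolding_mat r I J K G = mat (prod r I * prod r K) (prod r J)
     (\<lambda>(a, b). G (join I J (lex_tuple r I (a div prod r K)) (lex_tuple r J b)
                           (lex_tuple r K (a mod prod r K))))"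

definition vec_of_mat :: "real mat \<Rightarrow> real vec" where
  "vec_of_mat M = vec (dim_row M * dim_col M) (\<lambda>a. M $$ (a div dim_col M, a mod dim_col M))"

definition kron :: "real mat \<Rightarrow> real mat \<Rightarrow> real mat" where
  "kron A B = mat (dim_row A * dim_row B) (dim_col A * dim_col B)
     (\<lambda>(a, b). A $$ (a div dim_row B, b div dim_col B) * B $$ (a mod dim_row B, b mod dim_col B))"

definition kron_family :: "(nat \<Rightarrow> real mat) \<Rightarrow> nat set \<Rightarrow> real mat" where
  "kron_family U S = mat (\<Prod>j\<in>S. dim_row (U j)) (\<Prod>j\<in>S. dim_col (U j))
     (\<lambda>(a, b). \<Prod>j\<in>S. U j $$ (lex_tuple (\<lambda>j. dim_row (U j)) S a j,
                               lex_tuple (\<lambda>j. dim_col (U j)) S b j))"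

definition tri_feasible :: "real mat \<Rightarrow> nat \<Rightarrow> real mat \<times> real mat \<times> real mat \<Rightarrow> bool" where
  "tri_feasible M r = (\<lambda>(A, B, S).
     A \<in> carrier_mat (dim_row M) r \<and> B \<in> carrier_mat (dim_col M) r \<and> S \<in> carrier_mat r r \<and>
     M = A * S * B\<^sup>T \<and> col_stochastic A \<and> col_stochastic B \<and> nonneg_mat A \<and> nonneg_mat B)"

definition tri_optimal :: "real mat \<Rightarrow> nat \<Rightarrow> real mat \<times> real mat \<times> real mat \<Rightarrow> bool" where
  "tri_optimal M r = is_arg_min (\<lambda>(A, B, S). \<bar>det S\<bar>) (tri_feasible M r)"

definition bi_feasible :: "real mat \<Rightarrow> nat \<Rightarrow> real mat \<times> real mat \<Rightarrow> bool" where
  "bi_feasible M r = (\<lambda>(G, U).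
     G \<in> carrier_mat (dim_row M) r \<and> U \<in> carrier_mat (dim_col M) r \<and>
     M = G * U\<^sup>T \<and> col_stochastic U \<and> nonneg_mat U)"

definition bi_optimal :: "real mat \<Rightarrow> nat \<Rightarrow> real mat \<times> real mat \<Rightarrow> bool" where
  "bi_optimal M r = is_arg_min (\<lambda>(G, U). det (G\<^sup>T * G)) (bi_feasible M r)"

end

(* Both optimisation steps rest on one volume argument.  If H satisfies the SSC and H Q is again
   nonnegative and column stochastic, then by SSC1 every column of Q has entry sum 1 and Euclidean
   norm at most 1, so |det Q| <= 1 by Hadamard's inequality.  If |det Q| = 1, all columns have norm 1,
   hence lie on the boundary of C*, and SSC2 makes them standard basis vectors: Q is a permutation
   matrix.  Any feasible point arises from the true factorisation through such matrices Q, and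
   optimality forces |det Q| = 1.  In step 3, a permuted Kronecker product of column stochastic
   matrices that is again such a product is permuted mode by mode, because summing out the other modes
   isolates each factor.  The unfolding of G* is then that of G with all three index groups permuted. *)

theory Submission
  imports Defs
begin

subsection \<open>Rank\<close>

text \<open>The SSC also supplies the full rank on which the volume argument relies. By SSC1 the
  dual cone lies in the pointed cone \<open>C_star\<close>, so a matrix with the SSC is injective
  and has a left inverse. Hypothesis (ii) makes the core of the slice at \<open>i0\<close>
  invertible, and (iii) makes the unfolding of \<open>G\<close> injective. The true factors can
  therefore be cancelled, and every competing factor is a true one times a square matrix.

  The permutations found by the optimisation need not respect the modes: they permute positions of
  whole tuples, and so do the matrices chosen in step 3. Only their composite takes one Kronecker
  product to another, so it is the composite that is split mode by mode.

  The permutations of step 1 also disturb the data of step 2: column \<open>c\<close> of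
  \<open>S\<close> is the vectorised core of slice \<open>c\<close> with rows and columns permuted.
  This amounts to a row permutation of the unfolding, so step 2 is again a recovery problem, now
  with a rectangular factor whose volume is a Gram determinant.\<close>

lemma (in vec_space) full_rank_mult_zero:
  assumes A: "A \<in> carrier_mat n nc" and rank: "rank A = nc"
    and v: "v \<in> carrier_vec nc" and Av: "A *\<^sub>v v = 0\<^sub>v n"
  shows "v = 0\<^sub>v nc"
proof -
  \<comment> \<open>Linear independence is a property of the set of columns, in which equal columns
    collapse. A maximal independent subset has \<open>nc\<close> elements, so no two columns
    coincide.\<close>
  obtain S where S: "maximal S (\<lambda>T. T \<subseteq> set (cols A) \<and> lin_indpt T)"
    using maximal_exists[of "(\<lambda>T. T \<subseteq> set (cols A) \<and> lin_indpt T)" "card (set (cols A))" "{}"]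
    by (meson List.finite_set card_mono empty_iff empty_subsetI finite_lin_indpt2 rev_finite_subset)
  then have "card S \<le> card (set (cols A))" by (simp add: card_mono maximal_def)
  then have "nc \<le> card (set (cols A))"
    using rank_card_indpt[OF A S] rank by simp
  then have "distinct (cols A)"
    using A card_length[of "cols A"] by (intro card_distinct) simp
  then show ?thesis
    using full_rank_lin_indpt[OF A rank] lin_depI[OF A v _ Av] by blast
qed

lemma (in vec_space) rank_mult_le:
  assumes A: "A \<in> carrier_mat n m" and B: "B \<in> carrier_mat m nc"
  shows "rank (A * B) \<le> rank A"
proof -
  let ?W = "span (set (cols A))"
  have sA: "set (cols A) \<subseteq> carrier_vec n" and sAB: "set (cols (A * B)) \<subseteq> carrier_vec n"
    using A B cols_dim by (metis carrier_matD(1), metis carrier_matD(1) mult_carrier_mat)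
  have W: "subspace class_ring ?W V" using span_is_subspace[OF sA] .
  have "set (cols (A * B)) \<subseteq> ?W"
  proof
    fix x assume "x \<in> set (cols (A * B))"
    then obtain j where j: "j < nc" "x = col (A * B) j"
      using A B by (metis carrier_matD(2) cols_length cols_nth in_set_conv_nth index_mult_mat(3))
    then have "x = A *\<^sub>v col B j" using A B by (simp add: mult_mat_vec_def)
    also have "\<dots> = mat_of_cols n (cols A) *\<^sub>v vec (length (cols A)) (\<lambda>i. col B j $ i)"
    proof -
      have "vec (length (cols A)) (\<lambda>i. col B j $ i) = col B j" using A B j by auto
      moreover have "mat_of_cols n (cols A) = A" using A by auto
      ultimately show ?thesis by simp
    qed
    also have "\<dots> = lincomb_list (\<lambda>i. col B j $ i) (cols A)"
      using lincomb_list_as_mat_mult[of "cols A" "\<lambda>i. col B j $ i"] sA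
      by (metis carrier_vecD subsetD)
    finally have "x \<in> span_list (cols A)" by (auto simp: span_list_def)
    then show "x \<in> ?W" using span_list_as_span[OF sA] by simp
  qed
  then have "span (set (cols (A * B))) \<subseteq> ?W"
    using span_is_subset[of "set (cols (A * B))" ?W] span_is_submodule[OF sA] by blast
  then have "subspace class_ring (span (set (cols (A * B)))) (vs ?W)"
    using nested_subspaces[OF W] span_is_subspace[OF sAB] by blast
  then show ?thesis
    unfolding rank_def
    using vectorspace.subspace_dim[OF subspace_is_vs[OF W]]
      fin_dim_span_cols[OF A] fin_dim_span_cols[of "A * B" nc] A B by auto
qed

lemma mat_rank_full_inj:
  assumes "A \<in> carrier_mat m k" "mat_rank A = k" "v \<in> carrier_vec k" "A *\<^sub>v v = 0\<^sub>v m"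
  shows "v = 0\<^sub>v k"
  using assms vec_space.full_rank_mult_zero[of A m k v] by (simp add: mat_rank_def)

lemma mat_rank_mult_full:
  assumes A: "A \<in> carrier_mat m k" and B: "B \<in> carrier_mat k l" and r: "mat_rank (A * B) = k"
  shows "mat_rank A = k"
  using vec_space.rank_mult_le[OF A B] vec_space.rank_le_nc[OF A] A r
  by (simp add: mat_rank_def)

subsection \<open>Hadamard's inequality and the sufficiently scattered condition\<close>

text \<open>Hadamard's inequality.  Subtracting from the other columns their projections on the first column
  leaves the Gram determinant unchanged and does not lengthen any column.\<close>

lemma gram_det_bounds:
  fixes Q :: "real mat"
  assumes "Q \<in> carrier_mat m n"
  shows "0 \<le> det (Q\<^sup>T * Q) \<and> det (Q\<^sup>T * Q) \<le> (\<Prod>k<n. col Q k \<bullet> col Q k)"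
  using assms
proof (induction n arbitrary: Q)
  case 0
  then have "Q\<^sup>T * Q \<in> carrier_mat 0 0" by simp
  then show ?case by (simp add: det_dim_zero)
next
  case (Suc n)
  let ?q = "col Q 0"
  have q: "?q \<in> carrier_vec m" and qj: "col Q (Suc j) \<in> carrier_vec m" for j
    using Suc.prems by auto
  define a where "a = ?q \<bullet> ?q"
  \<comment> \<open>Coefficients of the projections on column 0. If \<open>a = 0\<close>, division
    by zero gives \<open>c j = 0\<close>, which is harmless because column 0 is then the zero
    vector.\<close>
  define c where "c j = (?q \<bullet> col Q j) / a" for j
  \<comment> \<open>The column operations as one unitriangular matrix, so that
    \<open>Q * E = P\<close> and \<open>det E = 1\<close>.\<close>
  define E where "E = mat (Suc n) (Suc n)
    (\<lambda>(i, j). (if i = j then 1 else 0) + (if i = 0 then (if j = 0 then 0 else - c j) else 0))"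
  define P where "P = mat m (Suc n) (\<lambda>(i, j). Q $$ (i, j) - (if j = 0 then 0 else c j * Q $$ (i, 0)))"
  define D where "D = mat m n (\<lambda>(i, j). P $$ (i, Suc j))"
  have E: "E \<in> carrier_mat (Suc n) (Suc n)" by (simp add: E_def)
  have P: "P \<in> carrier_mat m (Suc n)" by (simp add: P_def)
  have D: "D \<in> carrier_mat m n" by (simp add: D_def)
  have "upper_triangular E" by (auto simp: upper_triangular_def E_def)
  then have "det E = (\<Prod>i = 0..<Suc n. E $$ (i, i))"
    using det_upper_triangular[OF _ E] E by (simp add: prod_list_diag_prod)
  then have detE: "det E = 1" by (simp add: E_def)
  have QE: "Q * E = P"
  proof (rule eq_matI)
    fix i j assume "i < dim_row P" "j < dim_col P"
    then have i: "i < m" and j: "j < Suc n" using P by auto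
    have "(Q * E) $$ (i, j) = (\<Sum>k = 0..<Suc n. Q $$ (i, k) * E $$ (k, j))"
      using i j Suc.prems E by (simp add: scalar_prod_def)
    also have "\<dots> = (\<Sum>k = 0..<Suc n. (if k = j then Q $$ (i, k) else 0)
        + (if k = 0 then (if j = 0 then 0 else - c j * Q $$ (i, 0)) else 0))"
      by (rule sum.cong) (use j in \<open>auto simp: E_def algebra_simps\<close>)
    also have "\<dots> = P $$ (i, j)"
      using i j by (simp add: sum.distrib P_def del: sum.op_ivl_Suc)
    finally show "(Q * E) $$ (i, j) = P $$ (i, j)" .
  qed (use Suc.prems E P in auto)
  have "P\<^sup>T * P = E\<^sup>T * (Q\<^sup>T * Q) * E"
    unfolding QE[symmetric] using Suc.prems E
    by (simp add: transpose_mult[of Q m "Suc n" E "Suc n"] assoc_mult_mat[of _ "Suc n" "Suc n" _ m _ "Suc n"]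
        assoc_mult_mat[of _ "Suc n" "Suc n" _ "Suc n" _ "Suc n"] assoc_mult_mat[of _ "Suc n" m _ "Suc n" _ "Suc n"])
  then have "det (P\<^sup>T * P) = det (Q\<^sup>T * Q)"
    using Suc.prems E detE
    by (simp add: det_mult[of _ "Suc n"] det_transpose[of _ "Suc n"])
  moreover have colD: "col D j = col Q (Suc j) - c (Suc j) \<cdot>\<^sub>v ?q" if "j < n" for j
    using that Suc.prems by (intro eq_vecI) (auto simp: D_def P_def)
  have a0: "?q \<bullet> v = 0" if "a = 0" "v \<in> carrier_vec m" for v
  proof -
    have "(\<Sum>i = 0..<m. ?q $ i * ?q $ i) = 0"
      using that(1) Suc.prems by (simp add: a_def scalar_prod_def)
    then have "\<forall>i\<in>{0..<m}. ?q $ i * ?q $ i = 0"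
      by (subst (asm) sum_nonneg_eq_0_iff) auto
    then show ?thesis using that(2) by (simp add: scalar_prod_def)
  qed
  have orth: "?q \<bullet> col D j = 0" if "j < n" for j
  proof -
    have "?q \<bullet> col D j = ?q \<bullet> col Q (Suc j) - c (Suc j) * a"
      using colD[OF that] q qj by (simp add: scalar_prod_minus_distrib[of _ m] a_def)
    then show ?thesis using a0 qj by (cases "a = 0") (simp_all add: c_def)
  qed
  have colP0: "col P 0 = ?q" using Suc.prems by (intro eq_vecI) (auto simp: P_def)
  have colPS: "col P (Suc j) = col D j" if "j < n" for j
    using that by (intro eq_vecI) (auto simp: D_def P_def)
  \<comment> \<open>The other columns of \<open>P\<close> are orthogonal to column 0, so the Gram
    matrix is block diagonal and the induction hypothesis applies to \<open>D\<close>.\<close>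
  have "P\<^sup>T * P = four_block_mat (mat 1 1 (\<lambda>_. a)) (0\<^sub>m 1 n) (0\<^sub>m n 1) (D\<^sup>T * D)"
  proof (rule eq_matI, goal_cases)
    case (1 i j)
    then have ij: "i < Suc n" "j < Suc n" using D by auto
    have "(P\<^sup>T * P) $$ (i, j) = col P i \<bullet> col P j" using ij P by simp
    moreover have "col D l \<bullet> ?q = 0" if "l < n" for l
      using orth[OF that] q D that by (metis col_carrier_vec comm_scalar_prod)
    ultimately show ?case
      using ij D colP0 colPS orth by (cases i; cases j) (simp_all add: a_def)
  qed (use P D in auto)
  then have "det (P\<^sup>T * P) = a * det (D\<^sup>T * D)"
    using D by (simp add: det_four_block_mat_lower_left_zero_col[where n = n] det_single)
  moreover have "0 \<le> a"
    using q by (simp add: a_def scalar_prod_def sum_nonneg)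
  moreover have "col D j \<bullet> col D j \<le> col Q (Suc j) \<bullet> col Q (Suc j)" if "j < n" for j
  proof -
    let ?v = "col Q (Suc j)"
    have "col D j \<bullet> col D j = ?v \<bullet> ?v - 2 * c (Suc j) * (?q \<bullet> ?v) + c (Suc j) ^ 2 * a"
      using colD[OF that] q qj[of j]
      by (simp add: scalar_prod_minus_distrib[of _ m] minus_scalar_prod_distrib[of _ m] a_def
          comm_scalar_prod[of ?v m ?q] power2_eq_square algebra_simps)
    also have "\<dots> = ?v \<bullet> ?v - (?q \<bullet> ?v)\<^sup>2 / a"
      by (cases "a = 0") (simp_all add: c_def power2_eq_square)
    finally show ?thesis using \<open>0 \<le> a\<close> by simp
  qed
  then have "(\<Prod>k<n. col D k \<bullet> col D k) \<le> (\<Prod>k<n. col Q (Suc k) \<bullet> col Q (Suc k))"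
    by (intro prod_mono) (auto simp: scalar_prod_def sum_nonneg)
  ultimately show ?case
    using Suc.IH[OF D]
    by (simp add: prod.lessThan_Suc_shift a_def[symmetric] del: prod.lessThan_Suc)
       (metis mult_left_mono mult_nonneg_nonneg order_trans)
qed

text \<open>If the Gram matrix kills \<open>v\<close>, then
  \<open>(G v) . (G v) = v . (G^T G v) = 0\<close>, so \<open>G\<close> kills \<open>v\<close>
  too.\<close>

lemma det_gram_nonzero:
  fixes G :: "real mat"
  assumes G: "G \<in> carrier_mat m n"
    and inj: "\<And>v. v \<in> carrier_vec n \<Longrightarrow> G *\<^sub>v v = 0\<^sub>v m \<Longrightarrow> v = 0\<^sub>v n"
  shows "det (G\<^sup>T * G) \<noteq> 0"
proof
  assume "det (G\<^sup>T * G) = 0"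
  then obtain v where v: "v \<in> carrier_vec n" "v \<noteq> 0\<^sub>v n" "(G\<^sup>T * G) *\<^sub>v v = 0\<^sub>v n"
    using det_0_iff_vec_prod_zero[of "G\<^sup>T * G" n] G by auto
  define w where "w = G *\<^sub>v v"
  have w: "w \<in> carrier_vec m" using G v by (simp add: w_def)
  have "G\<^sup>T *\<^sub>v w = 0\<^sub>v n"
    using v(3) G v(1) by (simp add: w_def assoc_mult_mat_vec[of _ n m _ n])
  then have "w \<bullet> w = 0"
    using transpose_vec_mult_scalar[OF G v(1) w] v(1) by (simp add: w_def[symmetric])
  then have "(\<Sum>i = 0..<m. w $ i * w $ i) = 0" using w by (simp add: scalar_prod_def)
  then have "\<forall>i\<in>{0..<m}. w $ i * w $ i = 0" by (subst (asm) sum_nonneg_eq_0_iff) auto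
  then have "w = 0\<^sub>v m" using w by (intro eq_vecI) auto
  then show False using inj v by (simp add: w_def)
qed


section \<open>Euclidean norm and the cones of the SSC\<close>

lemma vec_norm2_sq: "x \<in> carrier_vec n \<Longrightarrow> (vec_norm2 x)\<^sup>2 = (\<Sum>i<n. (x $ i)\<^sup>2)"
  by (auto simp: vec_norm2_def L2_set_def sum_nonneg)

lemma vec_norm2_nonneg: "0 \<le> vec_norm2 x"
  by (simp add: vec_norm2_def)

lemma ones_scalar_prod: "x \<in> carrier_vec n \<Longrightarrow> ones n \<bullet> x = (\<Sum>i<n. x $ i)"
  by (auto simp: ones_def scalar_prod_def atLeast0LessThan)

lemma scalar_prod_self_sq: "x \<in> carrier_vec n \<Longrightarrow> x \<bullet> x = (vec_norm2 x)\<^sup>2"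
  by (subst vec_norm2_sq) (auto simp: scalar_prod_def atLeast0LessThan power2_eq_square)

lemma vec_norm2_le_iff:
  assumes "x \<in> carrier_vec n"
  shows "vec_norm2 x \<le> t \<longleftrightarrow> 0 \<le> t \<and> (\<Sum>i<n. (x $ i)\<^sup>2) \<le> t\<^sup>2"
  unfolding vec_norm2_sq[OF assms, symmetric]
  using vec_norm2_nonneg[of x] power_mono[of "vec_norm2 x" t 2] power2_le_imp_le[of "vec_norm2 x" t]
  by linarith

text \<open>SSC1 puts the circular cone around \<open>e\<close> into \<open>cone(H\<^sup>T)\<close>, so \<open>cone*(H\<^sup>T)\<close> lies in the dual of the
  circular cone, which is \<open>C_star\<close>.  The test vector is \<open>a e - w\<close>, where \<open>w\<close> is the component of \<open>y\<close>
  orthogonal to \<open>e\<close> and \<open>a\<close> is the least value that keeps it in the circular cone.\<close>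

lemma SSC1_dual_cone:
  assumes H: "H \<in> carrier_mat n r" and "2 \<le> r" and SSC1: "SSC1 H"
    and y: "y \<in> carrier_vec r" and Hy: "0\<^sub>v n \<le> H *\<^sub>v y"
  shows "y \<in> C_star r"
proof -
  define s where "s = (\<Sum>i<r. y $ i)"
  define t where "t = s / r"
  \<comment> \<open>\<open>y = t e + w\<close> with \<open>w\<close> orthogonal to \<open>e\<close>.
    The squared norm of \<open>y\<close> is \<open>N + s^2 / r\<close>, so besides
    \<open>0 \<le> s\<close> the goal amounts to \<open>N \<le> s^2 (r - 1) / r\<close>.\<close>
  define w where "w i = y $ i - t" for i
  define N where "N = (\<Sum>i<r. (w i)\<^sup>2)"
  have r: "real r \<ge> 2" using \<open>2 \<le> r\<close> by simp
  \<comment> \<open>A point \<open>x\<close> of the circular cone is \<open>H^T z\<close> with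
    \<open>z \<ge> 0\<close>, so its product with \<open>y\<close> is that of \<open>z\<close> with
    \<open>H y\<close>. The cone condition is squared to avoid roots.\<close>
  have dual: "0 \<le> (\<Sum>i<r. x i * y $ i)"
    if x: "\<And>i. i < r \<Longrightarrow> 0 \<le> x i" and c: "(real r - 1) * (\<Sum>i<r. (x i)\<^sup>2) \<le> (\<Sum>i<r. x i)\<^sup>2"
    for x
  proof -
    let ?x = "vec r x"
    have "(sqrt (real r - 1) * vec_norm2 ?x)\<^sup>2 \<le> (ones r \<bullet> ?x)\<^sup>2"
      using c r by (simp add: power_mult_distrib vec_norm2_sq[of _ r] ones_scalar_prod[of _ r])
    moreover have "0 \<le> ones r \<bullet> ?x"
      using x by (auto simp: ones_scalar_prod[of _ r] intro: sum_nonneg)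
    ultimately have "sqrt (real r - 1) * vec_norm2 ?x \<le> ones r \<bullet> ?x"
      by (rule power2_le_imp_le)
    moreover have "0\<^sub>v r \<le> ?x" using x by (simp add: less_eq_vec_def)
    ultimately have "?x \<in> mat_cone (H\<^sup>T)"
      using SSC1 H by (auto simp: SSC1_def Let_def)
    then obtain z where z: "?x = H\<^sup>T *\<^sub>v z" "z \<in> carrier_vec n" "0\<^sub>v n \<le> z"
      using H by (auto simp: mat_cone_def)
    have "z \<bullet> (H *\<^sub>v y) = ?x \<bullet> y"
      using z transpose_vec_mult_scalar[OF H y z(2)] by simp
    moreover have "0 \<le> z \<bullet> u" if "0\<^sub>v n \<le> u" "u \<in> carrier_vec n" for u
      using z that by (auto simp: scalar_prod_def less_eq_vec_def intro!: sum_nonneg mult_nonneg_nonneg)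
    from this[OF Hy] have "0 \<le> z \<bullet> (H *\<^sub>v y)" using y H by simp
    moreover have "?x \<bullet> y = (\<Sum>i<r. x i * y $ i)"
      using y by (auto simp: scalar_prod_def atLeast0LessThan)
    ultimately show ?thesis by simp
  qed
  have sw: "(\<Sum>i<r. w i) = 0"
    using r by (simp add: w_def sum_subtractf s_def[symmetric] t_def)
  have ysum: "(\<Sum>i<r. (y $ i)\<^sup>2) = N + s\<^sup>2 / r"
  proof -
    have "(\<Sum>i<r. (y $ i)\<^sup>2) = (\<Sum>i<r. (w i)\<^sup>2 + 2 * t * w i + t\<^sup>2)"
      by (rule sum.cong) (auto simp: w_def power2_eq_square algebra_simps)
    also have "\<dots> = N + r * t\<^sup>2"
      by (simp only: sum.distrib sum_distrib_left[symmetric] sw N_def) simp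
    also have "r * t\<^sup>2 = s\<^sup>2 / r" using r by (simp add: t_def power2_eq_square)
    finally show ?thesis .
  qed
  have N0: "0 \<le> N" by (simp add: N_def sum_nonneg)
  have s0: "0 \<le> s"
    using dual[of "\<lambda>_. 1"] r by (simp add: s_def power2_eq_square)
  have "N \<le> s\<^sup>2 * (real r - 1) / r"
  proof (cases "N = 0")
    case True then show ?thesis using r by simp
  next
    case False
    \<comment> \<open>Solves \<open>(r - 1) (r a^2 + N) = (r a)^2\<close>: the test vector
      \<open>a e - w\<close> meets the cone condition with equality.\<close>
    define a where "a = sqrt (N * (real r - 1) / r)"
    have a2: "a\<^sup>2 = N * (real r - 1) / r" and a0: "0 \<le> a"
      using N0 r by (simp_all add: a_def)
    \<comment> \<open>Nonnegativity of the test vector: the other \<open>r - 1\<close> entries sum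
      to \<open>- w i\<close>, and Cauchy-Schwarz bounds that sum.\<close>
    have "w i \<le> a" if "i < r" for i
    proof -
      have "w i = - (\<Sum>j\<in>{..<r} - {i}. w j)"
        using that sw by (simp add: sum.remove[of "{..<r}" i])
      then have "(w i)\<^sup>2 \<le> (\<Sum>j\<in>{..<r} - {i}. (w j)\<^sup>2) * real (card ({..<r} - {i}))"
        using sum_squared_le_sum_of_squares[of w "{..<r} - {i}"] by simp
      also have "\<dots> = (N - (w i)\<^sup>2) * (real r - 1)"
        using that by (simp add: N_def sum.remove[of "{..<r}" i] of_nat_diff)
      finally have "(w i)\<^sup>2 \<le> a\<^sup>2"
        using r unfolding a2 by (simp add: field_simps)
      then show ?thesis using a0 by (rule power2_le_imp_le)
    qed
    moreover have "(\<Sum>i<r. a - w i) = r * a" using sw by (simp add: sum_subtractf)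
    moreover have "(\<Sum>i<r. (a - w i)\<^sup>2) = r * a\<^sup>2 + N"
    proof -
      have "(\<Sum>i<r. (a - w i)\<^sup>2) = (\<Sum>i<r. a\<^sup>2 + (- 2 * a) * w i + (w i)\<^sup>2)"
        by (rule sum.cong) (auto simp: power2_eq_square algebra_simps)
      also have "\<dots> = r * a\<^sup>2 + N"
        by (simp only: sum.distrib sum_distrib_left[symmetric] sw N_def) simp
      finally show ?thesis .
    qed
    moreover have "r * a\<^sup>2 + N = r * N" unfolding a2 using r by (simp add: field_simps)
    moreover have "(real r * a)\<^sup>2 = (real r - 1) * (r * N)"
      unfolding power_mult_distrib a2 using r by (simp add: power2_eq_square)
    \<comment> \<open>Pairing with \<open>y\<close> gives \<open>N \<le> a s\<close>; squaring and
      cancelling one positive factor \<open>N\<close> yields the claim.\<close>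
    ultimately have "0 \<le> (\<Sum>i<r. (a - w i) * y $ i)"
      by (intro dual) auto
    also have "\<dots> = (\<Sum>i<r. a * y $ i + (- t) * w i - (w i)\<^sup>2)"
      by (rule sum.cong) (auto simp: w_def power2_eq_square algebra_simps)
    also have "\<dots> = a * s - N"
      by (simp add: sum.distrib sum_subtractf sum_distrib_left[symmetric] sum_negf sw N_def s_def)
    finally have "N\<^sup>2 \<le> (a * s)\<^sup>2" using N0 by (intro power_mono) auto
    also have "(a * s)\<^sup>2 = N * (s\<^sup>2 * (real r - 1) / r)"
      unfolding power_mult_distrib a2 by simp
    finally have "N * N \<le> N * (s\<^sup>2 * (real r - 1) / r)"
      by (simp only: power2_eq_square)
    moreover have "0 < N" using False N0 by simp
    ultimately show ?thesis by (simp only: mult_le_cancel_left_pos)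
  qed
  then have "N + s\<^sup>2 / r \<le> s\<^sup>2"
    using r by (simp add: field_simps)
  then show ?thesis
    using y s0 ysum by (simp add: C_star_def ones_scalar_prod[of _ r] s_def[symmetric] vec_norm2_le_iff)
qed

text \<open>\<open>C_star\<close> is pointed: both \<open>y\<close> and \<open>-y\<close> lie in it,
  so the entry sum of \<open>y\<close> is 0 and bounds its norm.\<close>

lemma SSC_inj:
  assumes H: "H \<in> carrier_mat n r" and SSC: "SSC H"
    and y: "y \<in> carrier_vec r" and Hy: "H *\<^sub>v y = 0\<^sub>v n"
  shows "y = 0\<^sub>v r"
proof -
  have r: "2 \<le> r" "SSC1 H" using SSC H by (auto simp: SSC_def)
  have "y \<in> C_star r" using SSC1_dual_cone[OF H r y] Hy by simp
  moreover have "row H i \<bullet> y = 0" if "i < n" for i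
    using arg_cong[OF Hy, of "\<lambda>v. v $ i"] H that by simp
  then have "H *\<^sub>v (- y) = 0\<^sub>v n"
    using y H by (intro eq_vecI) auto
  then have "- y \<in> C_star r" using SSC1_dual_cone[OF H r, of "- y"] y by simp
  ultimately have "(\<Sum>i<r. (y $ i)\<^sup>2) \<le> 0"
    using y by (auto simp: C_star_def vec_norm2_le_iff[of _ r] ones_scalar_prod[of _ r] sum_negf)
  moreover have "0 \<le> (\<Sum>i<r. (y $ i)\<^sup>2)" by (simp add: sum_nonneg)
  ultimately have "\<forall>i\<in>{..<r}. (y $ i)\<^sup>2 = 0"
    by (subst sum_nonneg_eq_0_iff[symmetric]) auto
  then show ?thesis using y by (intro eq_vecI) auto
qed

lemma C_star_frontier:
  assumes r: "2 \<le> r" and y: "y \<in> carrier_vec r" and s: "ones r \<bullet> y = 1" and n: "vec_norm2 y = 1"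
  shows "y \<in> vec_topology r frontier_of C_star r"
proof -
  interpret Metric_space "carrier_vec r" "vec_dist r" by (rule Metric_space_vec)
  have "C_star r \<subseteq> carrier_vec r" by (auto simp: C_star_def)
  then have "C_star r \<subseteq> vec_topology r closure_of C_star r"
    by (intro closure_of_subset) (simp add: vec_topology_def)
  then have "y \<in> vec_topology r closure_of C_star r"
    using y s n by (auto simp: C_star_def)
  moreover have "\<not> mball y e \<subseteq> C_star r" if "e > 0" for e
  proof -
    \<comment> \<open>The bound \<open>e / (2 * r)\<close> keeps the point in the ball, whose radius
      is \<open>e\<close>. Membership in \<open>C_star\<close> would force
      \<open>2 \<le> r * d\<close>, which \<open>d \<le> 1 / r\<close> excludes.\<close>
    define d where "d = min (e / (2 * r)) (1 / r)"
    have r': "real r \<ge> 2" using r by simp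
    have d: "0 < d" "d \<le> 1 / r" "d \<le> e / (2 * r)" using that r' by (auto simp: d_def)
    \<comment> \<open>moving along \<open>-e\<close> leaves the cone\<close>
    let ?x = "vec r (\<lambda>i. y $ i - d)"
    have s': "(\<Sum>i<r. y $ i) = 1" and n': "(\<Sum>i<r. (y $ i)\<^sup>2) = 1"
      using s n ones_scalar_prod[OF y] vec_norm2_sq[OF y] by simp_all
    have "vec_dist r y ?x = sqrt (r * d\<^sup>2)" by (simp add: vec_dist_def L2_set_def)
    also have "\<dots> \<le> r * d"
      using d r' by (intro real_le_lsqrt) (auto simp: power_mult_distrib power2_eq_square intro!: mult_right_mono)
    also have "\<dots> < e" using d(3) r' that by (simp add: field_simps)
    finally have "?x \<in> mball y e" using y by (simp add: in_mball)
    moreover have "?x \<notin> C_star r"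
    proof
      assume "?x \<in> C_star r"
      then have "(\<Sum>i<r. (y $ i - d)\<^sup>2) \<le> (\<Sum>i<r. y $ i - d)\<^sup>2"
        by (simp add: C_star_def vec_norm2_le_iff[of _ r] ones_scalar_prod[of _ r])
      also have "(\<Sum>i<r. y $ i - d) = 1 - r * d" by (simp add: sum_subtractf s')
      also have "(\<Sum>i<r. (y $ i - d)\<^sup>2) = (\<Sum>i<r. (y $ i)\<^sup>2 + (- 2 * d) * y $ i + d\<^sup>2)"
        by (rule sum.cong) (auto simp: power2_eq_square algebra_simps)
      also have "\<dots> = 1 - 2 * d + r * d\<^sup>2"
        by (simp only: sum.distrib sum_distrib_left[symmetric] s' n') simp
      finally have "2 * (r - 1) * d \<le> r * (r - 1) * d\<^sup>2"
        using r' by (simp add: power2_eq_square algebra_simps of_nat_diff)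
      then have "(r - 1) * d * 2 \<le> (r - 1) * d * (r * d)"
        by (simp add: power2_eq_square mult_ac)
      moreover have "0 < (real r - 1) * d" using r' d by simp
      ultimately have "2 \<le> r * d" using r by (simp add: of_nat_diff mult_le_cancel_left_pos)
      then show False using d(2) r' by (simp add: field_simps)
    qed
    ultimately show ?thesis by blast
  qed
  then have "y \<notin> vec_topology r interior_of C_star r"
    by (auto simp: vec_topology_def in_interior_of_mball)
  ultimately show ?thesis by (simp add: frontier_of_def)
qed

section \<open>Volume bound under the SSC\<close>

lemma col_stochastic_iff:
  assumes "U \<in> carrier_mat n r"
  shows "col_stochastic U \<longleftrightarrow> (\<forall>j<r. (\<Sum>i<n. U $$ (i, j)) = 1)"
  using assms by (auto simp: col_stochastic_def ones_def vec_eq_iff scalar_prod_def atLeast0LessThan)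

lemma nonneg_mat_iff:
  assumes "U \<in> carrier_mat n r"
  shows "nonneg_mat U \<longleftrightarrow> (\<forall>i<n. \<forall>j<r. 0 \<le> U $$ (i, j))"
  using assms by (auto simp: nonneg_mat_def less_eq_mat_def)

lemma nonneg_mat_col:
  "U \<in> carrier_mat n r \<Longrightarrow> nonneg_mat U \<Longrightarrow> k < r \<Longrightarrow> 0\<^sub>v n \<le> col U k"
  by (auto simp: nonneg_mat_iff less_eq_vec_def)

lemma SSC_volume:
  assumes H: "H \<in> carrier_mat n r" and SSC: "SSC H" and st: "col_stochastic H"
    and Q: "Q \<in> carrier_mat r r" and nn: "nonneg_mat (H * Q)" and st': "col_stochastic (H * Q)"
  shows "\<bar>det Q\<bar> \<le> 1" and "\<bar>det Q\<bar> = 1 \<Longrightarrow> permutation_mat r Q"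
proof -
  have r: "2 \<le> r" "SSC1 H" and SSC2: "SSC2 H" using SSC H by (auto simp: SSC_def)
  have HQ: "H * Q \<in> carrier_mat n r" using H Q by simp
  have colQ: "col Q k \<in> carrier_vec r" for k using Q by auto
  have Hcol: "H *\<^sub>v col Q k = col (H * Q) k" if "k < r" for k
    using H Q that by (simp add: mult_mat_vec_def)
  have nonneg: "0\<^sub>v n \<le> H *\<^sub>v col Q k" if "k < r" for k
    unfolding Hcol[OF that] by (rule nonneg_mat_col[OF HQ nn that])
  \<comment> \<open>Adding up the rows of \<open>H * Q\<close> collapses \<open>H\<close> to its
    column sums, which are 1, and leaves the column sums of \<open>Q\<close>.\<close>
  have sum1: "ones r \<bullet> col Q k = 1" if "k < r" for k
  proof -
    have "1 = (\<Sum>i<n. (H * Q) $$ (i, k))"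
      using st' that col_stochastic_iff[OF HQ] by simp
    also have "\<dots> = (\<Sum>i<n. \<Sum>j<r. H $$ (i, j) * Q $$ (j, k))"
      using H Q that by (auto simp: scalar_prod_def atLeast0LessThan)
    also have "\<dots> = (\<Sum>j<r. (\<Sum>i<n. H $$ (i, j)) * Q $$ (j, k))"
      by (subst sum.swap) (simp add: sum_distrib_right)
    also have "\<dots> = (\<Sum>j<r. Q $$ (j, k))"
      using st col_stochastic_iff[OF H] by simp
    also have "\<dots> = ones r \<bullet> col Q k"
      using Q that by (simp add: ones_scalar_prod[OF colQ])
    finally show ?thesis by simp
  qed
  have norm: "vec_norm2 (col Q k) \<le> 1" if "k < r" for k
    using SSC1_dual_cone[OF H r colQ nonneg[OF that]] sum1[OF that] by (simp add: C_star_def)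
  then have sq: "col Q k \<bullet> col Q k \<le> 1" "0 \<le> col Q k \<bullet> col Q k" if "k < r" for k
    using that vec_norm2_nonneg[of "col Q k"]
    by (simp_all add: scalar_prod_self_sq[OF colQ] power_le_one)
  have "(det Q)\<^sup>2 = det (Q\<^sup>T * Q)"
    using Q by (simp add: det_mult[of _ r] det_transpose[of _ r] power2_eq_square)
  then have had: "(det Q)\<^sup>2 \<le> (\<Prod>k<r. col Q k \<bullet> col Q k)"
    using gram_det_bounds[OF Q] by simp
  also have "\<dots> \<le> 1" using sq by (intro prod_le_1) auto
  finally show "\<bar>det Q\<bar> \<le> 1" by (simp add: abs_square_le_1)
  assume det1: "\<bar>det Q\<bar> = 1"
  \<comment> \<open>Hadamard's bound is a product of factors in [0, 1] that must reach 1, so no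
    factor falls short.\<close>
  have norm1: "vec_norm2 (col Q k) = 1" if k: "k < r" for k
  proof -
    have "1 \<le> (\<Prod>k<r. col Q k \<bullet> col Q k)"
      using had det1 by (metis abs_1 abs_power2 power2_abs power_one)
    also have "\<dots> = (col Q k \<bullet> col Q k) * (\<Prod>k\<in>{..<r} - {k}. col Q k \<bullet> col Q k)"
      using k by (simp add: prod.remove)
    also have "\<dots> \<le> (col Q k \<bullet> col Q k) * 1"
      using sq k by (intro mult_left_mono prod_le_1) auto
    finally have "1 \<le> (vec_norm2 (col Q k))\<^sup>2" by (simp add: scalar_prod_self_sq[OF colQ])
    then show ?thesis
      using norm[OF k] vec_norm2_nonneg[of "col Q k"] power2_le_imp_le[of 1 "vec_norm2 (col Q k)"]
      by simp
  qed
  have "\<exists>l<r. col Q k = unit_vec r l" if k: "k < r" for k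
  proof -
    have "col Q k \<in> dual_cone (H\<^sup>T)"
      using nonneg[OF k] H colQ by (simp add: dual_cone_def)
    moreover have "col Q k \<in> vec_topology r frontier_of C_star r"
      using C_star_frontier[OF r(1) colQ sum1[OF k] norm1[OF k]] .
    moreover have "dual_cone (H\<^sup>T) \<inter> (vec_topology r frontier_of C_star r)
        = {c \<cdot>\<^sub>v unit_vec r k |c k. 0 \<le> c \<and> k < r}"
      using SSC2 H by (simp add: SSC2_def Let_def)
    ultimately have "col Q k \<in> {c \<cdot>\<^sub>v unit_vec r k |c k. 0 \<le> c \<and> k < r}" by blast
    then obtain c l where l: "l < r" "col Q k = c \<cdot>\<^sub>v unit_vec r l" by blast
    \<comment> \<open>The entry sum 1 fixes the scale \<open>c\<close> on the ray.\<close>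
    have "ones r \<bullet> (c \<cdot>\<^sub>v unit_vec r l) = c"
      using l(1) by (simp add: ones_def)
    then show ?thesis using l sum1[OF k] by auto
  qed
  then obtain f where f: "\<And>k. k < r \<Longrightarrow> f k < r \<and> col Q k = unit_vec r (f k)" by metis
  have "inj_on f {..<r}"
  proof (rule inj_onI, rule ccontr)
    fix a b assume "a \<in> {..<r}" "b \<in> {..<r}" "f a = f b" "a \<noteq> b"
    then have "det Q = 0" using f Q by (intro det_identical_columns[OF Q, of a b]) auto
    then show False using det1 by simp
  qed
  moreover have "f ` {..<r} \<subseteq> {..<r}" using f by auto
  ultimately have bij: "bij_betw f {..<r} {..<r}"
    by (simp add: bij_betw_def endo_inj_surj)
  define p where "p k = (if k < r then f k else k)" for k
  have "bij_betw p {..<r} {..<r}"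
    using bij bij_betw_cong[of "{..<r}" p f "{..<r}"] by (simp add: p_def)
  then have "p permutes {..<r}" by (rule bij_imp_permutes) (simp add: p_def)
  moreover have "Q = mat r r (\<lambda>(i, j). if i = p j then 1 else 0)"
  proof (rule eq_matI, goal_cases)
    case (1 i j)
    then have "Q $$ (i, j) = col Q j $ i" using Q by simp
    also have "\<dots> = (if i = p j then 1 else 0)" using 1 f[of j] by (simp add: p_def)
    finally show ?case using 1 by simp
  qed (use Q in auto)
  ultimately show "permutation_mat r Q" unfolding permutation_mat_def by blast
qed

subsection \<open>Recovery of the factors from optimal solutions\<close>

text \<open>Premises on \<open>dim_row\<close> and \<open>dim_col\<close>, unlike carrier premises,
  introduce no further dimension variables, so \<open>simp\<close> can discharge them while
  rewriting.\<close>

lemma mat_assoc: 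
  fixes A B C :: "'a :: semiring_0 mat"
  shows "dim_col A = dim_row B \<Longrightarrow> dim_col B = dim_row C \<Longrightarrow> A * B * C = A * (B * C)"
  by (rule assoc_mult_mat[of _ "dim_row A" "dim_col A" _ "dim_col B" _ "dim_col C"]) auto

lemma mat_transpose_mult:
  fixes A B :: "'a :: comm_semiring_0 mat"
  shows "dim_col A = dim_row B \<Longrightarrow> (A * B)\<^sup>T = B\<^sup>T * A\<^sup>T"
  by (rule transpose_mult[of _ "dim_row A" "dim_col A" _ "dim_col B"]) auto

section \<open>Inverses and the Moore-Penrose inverse\<close>

lemma det_nonzero_inverse:
  fixes A :: "real mat"
  assumes "A \<in> carrier_mat n n" "det A \<noteq> 0"
  obtains B where "B \<in> carrier_mat n n" "A * B = 1\<^sub>m n" "B * A = 1\<^sub>m n"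
proof -
  have "A \<in> Units (ring_mat TYPE(real) n ())"
    using assms by (rule det_non_zero_imp_unit)
  then show thesis using that by (auto simp: Units_def ring_mat_def)
qed

text \<open>Symmetry lets the projections be commuted: \<open>A X = A Y A X\<close> is the transpose
  of \<open>A X A Y = A Y\<close>, hence equals \<open>A Y\<close>; likewise
  \<open>X A = Y A\<close>. Then \<open>X = X A X = X A Y = Y A Y = Y\<close>.\<close>

lemma penrose_inverse_unique:
  assumes X: "penrose_inverse A X" and Y: "penrose_inverse A Y"
  shows "X = Y"
proof -
  have [simp]: "dim_row X = dim_col A" "dim_col X = dim_row A" "dim_row Y = dim_col A" "dim_col Y = dim_row A"
    using X Y by (auto simp: penrose_inverse_def)
  have x: "A * X * A = A" "X * A * X = X" "(A * X)\<^sup>T = A * X" "(X * A)\<^sup>T = X * A"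
    and y: "A * Y * A = A" "Y * A * Y = Y" "(A * Y)\<^sup>T = A * Y" "(Y * A)\<^sup>T = Y * A"
    using X Y by (auto simp: penrose_inverse_def)
  have "A * X = (A * Y) * (A * X)" 
    using y(1) by (simp add: mat_assoc[symmetric])
  also have "\<dots> = ((A * X) * (A * Y))\<^sup>T" by (simp add: mat_transpose_mult[of "A * X"] x y)
  also have "(A * X) * (A * Y) = A * Y"
    using x(1) by (simp add: mat_assoc[symmetric])
  finally have 1: "A * X = A * Y" using y by simp
  have "X * A = (X * A) * (Y * A)" using y(1) by (simp add: mat_assoc)
  also have "\<dots> = ((Y * A) * (X * A))\<^sup>T" by (simp add: mat_transpose_mult[of "Y * A"] x y)
  also have "(Y * A) * (X * A) = Y * A"
    using x(1) by (simp add: mat_assoc)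
  finally have 2: "X * A = Y * A" using y by simp
  have "X = X * (A * X)" using x(2) by (simp add: mat_assoc)
  also have "\<dots> = X * A * Y" using 1 by (simp add: mat_assoc)
  also have "\<dots> = Y" using 2 y(2) by simp
  finally show ?thesis .
qed

lemma mp_inverse_eqI: "penrose_inverse A X \<Longrightarrow> mp_inverse A = X"
  unfolding mp_inverse_def using penrose_inverse_unique by blast

lemma penrose_inverse_transpose:
  assumes "penrose_inverse A X"
  shows "penrose_inverse (A\<^sup>T) (X\<^sup>T)"
proof -
  have [simp]: "dim_row X = dim_col A" "dim_col X = dim_row A"
    using assms by (auto simp: penrose_inverse_def)
  have "A\<^sup>T * X\<^sup>T * A\<^sup>T = (A * X * A)\<^sup>T" "X\<^sup>T * A\<^sup>T * X\<^sup>T = (X * A * X)\<^sup>T"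
    "A\<^sup>T * X\<^sup>T = (X * A)\<^sup>T" "X\<^sup>T * A\<^sup>T = (A * X)\<^sup>T"
    by (simp_all add: mat_transpose_mult mat_assoc)
  then show ?thesis using assms by (simp add: penrose_inverse_def)
qed

text \<open>With full column rank the inverse is explicit: \<open>N * X^T\<close>, where
  \<open>N\<close> inverts the Gram matrix. Symmetry of \<open>N\<close> gives the symmetry of
  \<open>X * L\<close> among the Penrose equations.\<close>

lemma mp_inverse_full_column_rank:
  assumes X: "X \<in> carrier_mat m r"
    and inj: "\<And>v. v \<in> carrier_vec r \<Longrightarrow> X *\<^sub>v v = 0\<^sub>v m \<Longrightarrow> v = 0\<^sub>v r"
  shows "mp_inverse X \<in> carrier_mat r m" and "mp_inverse X * X = 1\<^sub>m r"
    and "mp_inverse (X\<^sup>T) = (mp_inverse X)\<^sup>T"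
proof -
  have [simp]: "dim_row X = m" "dim_col X = r" using X by auto
  obtain N where N: "N \<in> carrier_mat r r" and XN: "X\<^sup>T * X * N = 1\<^sub>m r" and NX: "N * (X\<^sup>T * X) = 1\<^sub>m r"
    using det_nonzero_inverse[of "X\<^sup>T * X" r] det_gram_nonzero[OF X inj] X by auto
  have [simp]: "dim_row N = r" "dim_col N = r" using N by auto
  have "N\<^sup>T * (X\<^sup>T * X) = (X\<^sup>T * X * N)\<^sup>T" by (simp add: mat_transpose_mult mat_assoc)
  then have NT: "N\<^sup>T * (X\<^sup>T * X) = 1\<^sub>m r" by (simp add: XN)
  have "N\<^sup>T = N\<^sup>T * (X\<^sup>T * X * N)" using N by (simp add: XN)
  also have "\<dots> = N\<^sup>T * (X\<^sup>T * X) * N" by (simp add: mat_assoc)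
  also have "\<dots> = N" using N by (simp add: NT)
  finally have sym: "N\<^sup>T = N" .
  define L where "L = N * X\<^sup>T"
  have L: "L \<in> carrier_mat r m" and [simp]: "dim_row L = r" "dim_col L = m" by (auto simp: L_def)
  have LX: "L * X = 1\<^sub>m r" using NX by (simp add: L_def mat_assoc)
  have "(X * L)\<^sup>T = X * L" by (simp add: L_def mat_transpose_mult sym mat_assoc)
  moreover have "X * L * X = X" by (simp add: mat_assoc LX)
  ultimately have pen: "penrose_inverse X L"
    using L LX by (simp add: penrose_inverse_def)
  show "mp_inverse X \<in> carrier_mat r m" "mp_inverse X * X = 1\<^sub>m r"
    using mp_inverse_eqI[OF pen] L LX by simp_all
  show "mp_inverse (X\<^sup>T) = (mp_inverse X)\<^sup>T"
    using mp_inverse_eqI[OF pen] mp_inverse_eqI[OF penrose_inverse_transpose[OF pen]] by simp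
qed

lemma SSC_left_inverse:
  assumes H: "H \<in> carrier_mat n r" and "SSC H"
  obtains L where "L \<in> carrier_mat r n" "L * H = 1\<^sub>m r"
  using mp_inverse_full_column_rank[OF H SSC_inj[OF assms]] by blast

section \<open>Cancellation and comparison of factorisations\<close>

lemma right_cancel_transpose:
  fixes X Y B L :: "real mat"
  assumes X: "X \<in> carrier_mat m r" and Y: "Y \<in> carrier_mat m r" and B: "B \<in> carrier_mat n r"
    and L: "L \<in> carrier_mat r n" "L * B = 1\<^sub>m r" and eq: "X * B\<^sup>T = Y * B\<^sup>T"
  shows "X = Y"
proof -
  have BL: "B\<^sup>T * L\<^sup>T = 1\<^sub>m r" using B L by (simp add: transpose_mult[symmetric])
  have "X = X * B\<^sup>T * L\<^sup>T" using X B L BL by (simp add: mat_assoc)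
  also have "\<dots> = Y" unfolding eq using Y B L BL by (simp add: mat_assoc)
  finally show ?thesis .
qed

lemma left_cancel:
  fixes X Y A L :: "real mat"
  assumes X: "X \<in> carrier_mat r m" and Y: "Y \<in> carrier_mat r m" and A: "A \<in> carrier_mat n r"
    and L: "L \<in> carrier_mat r n" "L * A = 1\<^sub>m r" and eq: "A * X = A * Y"
  shows "X = Y"
proof -
  have "X = L * (A * X)" using X A L by (simp add: mat_assoc[symmetric])
  also have "\<dots> = Y" unfolding eq using Y A L by (simp add: mat_assoc[symmetric])
  finally show ?thesis .
qed

text \<open>\<open>LA U Y RX = LA A X RX = 1\<close>, and square matrices whose product is 1 are
  invertible. So \<open>Y RX\<close> has an inverse \<open>Z\<close>, and
  \<open>U = U Y RX Z = A X RX Z = A Z\<close>.\<close>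

lemma factor_through:
  fixes A X U Y LA LX :: "real mat"
  assumes A: "A \<in> carrier_mat m r" and X: "X \<in> carrier_mat r k"
    and U: "U \<in> carrier_mat m r" and Y: "Y \<in> carrier_mat r k"
    and LA: "LA \<in> carrier_mat r m" "LA * A = 1\<^sub>m r" and RX: "RX \<in> carrier_mat k r" "X * RX = 1\<^sub>m r"
    and eq: "A * X = U * Y"
  obtains Q where "Q \<in> carrier_mat r r" "U = A * Q"
proof -
  have "(LA * U) * (Y * RX) = LA * (U * Y) * RX"
    using A X U Y LA RX by (simp add: mat_assoc)
  also have "\<dots> = (LA * A) * (X * RX)"
    unfolding eq[symmetric] using A X U Y LA(1) RX(1) by (simp add: mat_assoc)
  finally have "(LA * U) * (Y * RX) = 1\<^sub>m r" using LA RX by simp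
  moreover have "det (LA * U * (Y * RX)) = det (LA * U) * det (Y * RX)"
    by (rule det_mult[of _ r]) (use LA U Y RX in auto)
  ultimately have "det (LA * U) * det (Y * RX) = 1" by simp
  then have "det (Y * RX) \<noteq> 0" by auto
  then obtain Z where Z: "Z \<in> carrier_mat r r" "Y * RX * Z = 1\<^sub>m r"
    using det_nonzero_inverse[of "Y * RX" r] Y RX by auto
  have "U = U * (Y * RX * Z)" using Z U by simp
  also have "\<dots> = (U * Y) * RX * Z" using U Y RX Z by (simp add: mat_assoc)
  also have "\<dots> = A * (X * RX * Z)"
    unfolding eq[symmetric] using A X RX(1) Z by (simp add: mat_assoc)
  also have "X * RX * Z = Z" using RX Z by simp
  finally show thesis using that Z by blast
qed

text \<open>The true triple is feasible, and \<open>S0 = P S1 Q^T\<close> relates it to the optimum.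
  Neither \<open>P\<close> nor \<open>Q\<close> can enlarge a determinant, and optimality of
  \<open>S1\<close> forbids that they shrink one.\<close>

lemma tri_recover:
  assumes A: "A \<in> carrier_mat m r" "SSC A" "col_stochastic A"
    and B: "B \<in> carrier_mat k r" "SSC B" "col_stochastic B"
    and S0: "S0 \<in> carrier_mat r r" "det S0 \<noteq> 0"
    and M: "M = A * S0 * B\<^sup>T" and opt: "tri_optimal M r (UI, UK, S1)"
  obtains P Q where "permutation_mat r P" "permutation_mat r Q" "UI = A * P" "UK = B * Q"
proof -
  have dimM: "dim_row M = m" "dim_col M = k" using A B by (simp_all add: M)
  note opt' = opt[unfolded tri_optimal_def is_arg_min_linorder]
  have feas: "tri_feasible M r (UI, UK, S1)" using opt' by blast
  have min: "\<bar>det S1\<bar> \<le> \<bar>det S\<bar>" if "tri_feasible M r (A, B, S)" for A B S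
    using opt'[THEN conjunct2, rule_format, OF that] by simp
  have UI: "UI \<in> carrier_mat m r" "col_stochastic UI" "nonneg_mat UI"
    and UK: "UK \<in> carrier_mat k r" "col_stochastic UK" "nonneg_mat UK"
    and S1: "S1 \<in> carrier_mat r r" and M': "M = UI * S1 * UK\<^sup>T"
    using feas dimM by (auto simp: tri_feasible_def)
  have "tri_feasible M r (A, B, S0)"
    using A B S0 M dimM by (auto simp: tri_feasible_def SSC_def)
  then have le: "\<bar>det S1\<bar> \<le> \<bar>det S0\<bar>" by (rule min)
  obtain LA where LA: "LA \<in> carrier_mat r m" "LA * A = 1\<^sub>m r" using SSC_left_inverse A by blast
  obtain LB where LB: "LB \<in> carrier_mat r k" "LB * B = 1\<^sub>m r" using SSC_left_inverse B by blast
  obtain R where R: "R \<in> carrier_mat r r" "S0 * R = 1\<^sub>m r" "R * S0 = 1\<^sub>m r"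
    using det_nonzero_inverse S0 by blast
  note cs = A(1) B(1) S0(1) UI(1) UK(1) S1 LA(1) LB(1) R(1)
  have BL: "B\<^sup>T * LB\<^sup>T = 1\<^sub>m r" using B LB by (simp add: transpose_mult[symmetric])
  have AL: "A\<^sup>T * LA\<^sup>T = 1\<^sub>m r" using A LA by (simp add: transpose_mult[symmetric])
  have RT: "S0\<^sup>T * R\<^sup>T = 1\<^sub>m r" using S0 R by (simp add: transpose_mult[symmetric])
  have "(S0 * B\<^sup>T) * (LB\<^sup>T * R) = S0 * (B\<^sup>T * LB\<^sup>T) * R" using cs by (simp add: mat_assoc)
  then have r1: "(S0 * B\<^sup>T) * (LB\<^sup>T * R) = 1\<^sub>m r" using BL R cs by simp
  note MM = trans[OF M[symmetric] M']
  \<comment> \<open>Read from the left, the equation expresses \<open>UI\<close> through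
    \<open>A\<close>; transposed, as \<open>e2\<close>, it expresses \<open>UK\<close> through
    \<open>B\<close>.\<close>
  have e1: "A * (S0 * B\<^sup>T) = UI * (S1 * UK\<^sup>T)"
    using MM cs by (simp add: mat_assoc)
  obtain P where P: "P \<in> carrier_mat r r" "UI = A * P"
    by (rule factor_through[OF A(1) _ UI(1) _ LA _ r1 e1, of k]) (use cs in \<open>simp_all add: mult_carrier_mat[of _ r r]\<close>)
  have "(S0\<^sup>T * A\<^sup>T) * (LA\<^sup>T * R\<^sup>T) = S0\<^sup>T * (A\<^sup>T * LA\<^sup>T) * R\<^sup>T" using cs by (simp add: mat_assoc)
  then have r2: "(S0\<^sup>T * A\<^sup>T) * (LA\<^sup>T * R\<^sup>T) = 1\<^sub>m r" using AL RT cs by simp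
  have e2: "B * (S0\<^sup>T * A\<^sup>T) = UK * (S1\<^sup>T * UI\<^sup>T)"
    using arg_cong[OF MM, of transpose_mat] cs by (simp add: mat_assoc mat_transpose_mult)
  obtain Q where Q: "Q \<in> carrier_mat r r" "UK = B * Q"
    by (rule factor_through[OF B(1) _ UK(1) _ LB _ r2 e2, of m]) (use cs in \<open>simp_all add: mult_carrier_mat[of _ r r]\<close>)
  have "A * (S0 * B\<^sup>T) = A * (P * S1 * Q\<^sup>T * B\<^sup>T)"
    unfolding e1 using P(1) Q(1) cs by (simp add: P(2) Q(2) mat_assoc mat_transpose_mult)
  then have "S0 * B\<^sup>T = P * S1 * Q\<^sup>T * B\<^sup>T"
    by (rule left_cancel[OF _ _ A(1) LA, of _ k, rotated 2]) (use P Q cs in auto)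
  then have "S0 = P * S1 * Q\<^sup>T"
    by (rule right_cancel_transpose[OF _ _ B(1) LB, of _ r, rotated 2]) (use P Q cs in auto)
  then have "det S0 = det P * det S1 * det Q"
    using P Q cs by (simp add: det_mult[of _ r] det_transpose[of _ r])
  then have *: "\<bar>det S0\<bar> = \<bar>det P\<bar> * \<bar>det S1\<bar> * \<bar>det Q\<bar>" by (simp add: abs_mult)
  have vP: "\<bar>det P\<bar> \<le> 1" "\<bar>det P\<bar> = 1 \<Longrightarrow> permutation_mat r P"
    using SSC_volume[OF A P(1)] UI P(2) by auto
  have vQ: "\<bar>det Q\<bar> \<le> 1" "\<bar>det Q\<bar> = 1 \<Longrightarrow> permutation_mat r Q"
    using SSC_volume[OF B Q(1)] UK Q(2) by auto
  have "\<bar>det S1\<bar> * 1 \<le> \<bar>det S1\<bar> * (\<bar>det P\<bar> * \<bar>det Q\<bar>)" using le * by (simp add: mult_ac)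
  moreover have "0 < \<bar>det S1\<bar>" using * S0(2) by auto
  ultimately have ge: "1 \<le> \<bar>det P\<bar> * \<bar>det Q\<bar>" by (simp only: mult_le_cancel_left_pos)
  have "\<bar>det P\<bar> * \<bar>det Q\<bar> \<le> \<bar>det P\<bar>" "\<bar>det P\<bar> * \<bar>det Q\<bar> \<le> \<bar>det Q\<bar>"
    using vP(1) vQ(1) by (simp_all add: mult_left_le mult_left_le_one_le)
  then have "\<bar>det P\<bar> = 1" "\<bar>det Q\<bar> = 1" using ge vP(1) vQ(1) by linarith+
  then show thesis using that vP(2) vQ(2) P(2) Q(2) by blast
qed

text \<open>The factor \<open>G\<close> is rectangular, so the Gram determinant replaces the
  determinant and \<open>det Q\<close> enters squared: \<open>F = G Q^T\<close> gives
  \<open>det (F^T F) = (det Q)^2 det (G^T G)\<close>.\<close>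

lemma bi_recover:
  assumes B: "B \<in> carrier_mat k r" "SSC B" "col_stochastic B"
    and F: "F \<in> carrier_mat m r" "\<And>v. v \<in> carrier_vec r \<Longrightarrow> F *\<^sub>v v = 0\<^sub>v m \<Longrightarrow> v = 0\<^sub>v r"
    and M: "M = F * B\<^sup>T" and opt: "bi_optimal M r (G, U)"
  obtains Q where "permutation_mat r Q" "U = B * Q" "F = G * Q\<^sup>T"
proof -
  have dimM: "dim_row M = m" "dim_col M = k" using F B by (simp_all add: M)
  note opt' = opt[unfolded bi_optimal_def is_arg_min_linorder]
  have feas: "bi_feasible M r (G, U)" using opt' by blast
  have min: "det (G\<^sup>T * G) \<le> det (G'\<^sup>T * G')" if "bi_feasible M r (G', U)" for G' U
    using opt'[THEN conjunct2, rule_format, OF that] by simp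
  have U: "U \<in> carrier_mat k r" "col_stochastic U" "nonneg_mat U"
    and G: "G \<in> carrier_mat m r" and M': "M = G * U\<^sup>T"
    using feas dimM by (auto simp: bi_feasible_def)
  have "bi_feasible M r (F, B)"
    using B F M dimM by (auto simp: bi_feasible_def SSC_def)
  then have le: "det (G\<^sup>T * G) \<le> det (F\<^sup>T * F)" by (rule min)
  obtain LB where LB: "LB \<in> carrier_mat r k" "LB * B = 1\<^sub>m r" using SSC_left_inverse B by blast
  obtain LF where LF: "LF \<in> carrier_mat r m" "LF * F = 1\<^sub>m r"
    using mp_inverse_full_column_rank[OF F] by blast
  have FL: "F\<^sup>T * LF\<^sup>T = 1\<^sub>m r" using F(1) LF by (simp add: transpose_mult[symmetric])
  note cs = B(1) F(1) U(1) G LB(1) LF(1)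
  note MM = trans[OF M[symmetric] M']
  have e: "B * F\<^sup>T = U * G\<^sup>T"
    using arg_cong[OF MM, of transpose_mat] cs by (simp add: mat_transpose_mult)
  obtain Q where Q: "Q \<in> carrier_mat r r" "U = B * Q"
    by (rule factor_through[OF B(1) _ U(1) _ LB _ FL e, of m]) (use cs in simp_all)
  have "F * B\<^sup>T = (G * Q\<^sup>T) * B\<^sup>T"
    unfolding MM using Q(1) cs by (simp add: Q(2) mat_assoc mat_transpose_mult)
  then have FQ: "F = G * Q\<^sup>T"
    by (rule right_cancel_transpose[OF _ _ B(1) LB, of _ m, rotated 2]) (use Q cs in auto)
  then have "F\<^sup>T * F = Q * (G\<^sup>T * G) * Q\<^sup>T"
    using Q cs by (simp add: mat_assoc mat_transpose_mult)
  then have *: "det (F\<^sup>T * F) = (det Q)\<^sup>2 * det (G\<^sup>T * G)"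
    using Q cs by (simp add: det_mult[of _ r] det_transpose[of _ r] power2_eq_square)
  have "det (F\<^sup>T * F) \<noteq> 0" using det_gram_nonzero[OF F] .
  then have "det (G\<^sup>T * G) \<noteq> 0" using * by auto
  then have pos: "0 < det (G\<^sup>T * G)" using gram_det_bounds[OF G] by simp
  have "det (G\<^sup>T * G) * 1 \<le> det (G\<^sup>T * G) * (det Q)\<^sup>2" using le * by (simp add: mult_ac)
  then have "1 \<le> (det Q)\<^sup>2" using pos by (simp only: mult_le_cancel_left_pos)
  then have "1 \<le> \<bar>det Q\<bar>" using abs_le_square_iff[of 1 "det Q"] by simp
  moreover have "\<bar>det Q\<bar> \<le> 1" "\<bar>det Q\<bar> = 1 \<Longrightarrow> permutation_mat r Q"
    using SSC_volume[OF B Q(1)] U Q(2) by auto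
  ultimately show thesis using that Q(2) FQ by simp
qed

subsection \<open>Permutation matrices and Kronecker products\<close>

text \<open>Names the matrix under the quantifier in \<open>permutation_mat\<close>. Column
  \<open>j\<close> is the unit vector at \<open>p j\<close>, so right multiplication reads column
  \<open>p j\<close> and products compose as \<open>p \<circ> q\<close>.\<close>

definition perm_mat :: "nat \<Rightarrow> (nat \<Rightarrow> nat) \<Rightarrow> real mat" where
  "perm_mat n p = mat n n (\<lambda>(i, j). if i = p j then 1 else 0)"

lemma perm_mat_carrier [simp]: "perm_mat n p \<in> carrier_mat n n"
  and dim_perm_mat [simp]: "dim_row (perm_mat n p) = n" "dim_col (perm_mat n p) = n"
  by (simp_all add: perm_mat_def)

lemma permutation_mat_iff:
  "permutation_mat n P \<longleftrightarrow> (\<exists>p. p permutes {..<n} \<and> P = perm_mat n p)"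
  by (simp add: permutation_mat_def perm_mat_def)

lemma permutes_less: "p permutes {..<n} \<Longrightarrow> i < n \<Longrightarrow> p i < (n::nat)"
  using permutes_in_image[of p "{..<n}" i] by simp

lemma mult_perm_mat:
  assumes "X \<in> carrier_mat m n" "i < m" "j < n" "p j < n"
  shows "(X * perm_mat n p) $$ (i, j) = X $$ (i, p j)"
proof -
  have "(X * perm_mat n p) $$ (i, j) = (\<Sum>k = 0..<n. if k = p j then X $$ (i, k) else 0)"
    using assms by (simp add: scalar_prod_def perm_mat_def if_distrib cong: if_cong)
  then show ?thesis using assms by simp
qed

lemma transpose_perm_mat_mult:
  assumes "X \<in> carrier_mat n m" "i < n" "j < m" "p i < n"
  shows "((perm_mat n p)\<^sup>T * X) $$ (i, j) = X $$ (p i, j)"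
proof -
  have "((perm_mat n p)\<^sup>T * X) $$ (i, j) = (\<Sum>k = 0..<n. if k = p i then X $$ (k, j) else 0)"
    using assms by (simp add: scalar_prod_def perm_mat_def if_distrib[of "\<lambda>c. c * _"] cong: if_cong)
  then show ?thesis using assms by simp
qed

lemma perm_mat_comp:
  assumes "q permutes {..<n}"
  shows "perm_mat n p * perm_mat n q = perm_mat n (p \<circ> q)"
proof (rule eq_matI, goal_cases)
  case (1 i j)
  then show ?case
    using mult_perm_mat[of "perm_mat n p" n n i j q] permutes_less[OF assms, of j]
    by (simp add: perm_mat_def)
qed auto

lemma perm_mat_orthogonal:
  assumes p: "p permutes {..<n}"
  shows "(perm_mat n p)\<^sup>T * perm_mat n p = 1\<^sub>m n" and "perm_mat n p * (perm_mat n p)\<^sup>T = 1\<^sub>m n"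
proof -
  show 1: "(perm_mat n p)\<^sup>T * perm_mat n p = 1\<^sub>m n"
  proof (rule eq_matI, goal_cases)
    case (1 i j)
    then have "((perm_mat n p)\<^sup>T * perm_mat n p) $$ (i, j) = perm_mat n p $$ (p i, j)"
      using permutes_less[OF p] by (intro transpose_perm_mat_mult[of _ _ n]) auto
    also have "\<dots> = (if i = j then 1 else 0)"
      using 1 permutes_less[OF p] inj_eq[OF permutes_inj[OF p]] by (simp add: perm_mat_def)
    finally show ?case using 1 by simp
  qed auto
  show "perm_mat n p * (perm_mat n p)\<^sup>T = 1\<^sub>m n"
    by (rule mat_mult_left_right_inverse[OF _ _ 1]) auto
qed

text \<open>Since \<open>q\<close> maps below \<open>n\<close>, quotient and remainder by
  \<open>n\<close> recover both components of the image pair.\<close>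

lemma kron_perm_mat:
  "kron (perm_mat m p) (perm_mat n q) =
     perm_mat (m * n) (\<lambda>x. p (x div n) * n + q (x mod n))" if q: "q permutes {..<n}"
proof (rule eq_matI, goal_cases)
  case (1 i j)
  then have ij: "i < m * n" "j < m * n" by simp_all
  then have n: "0 < n" by (auto intro: gr0I)
  have div: "i div n < m" "j div n < m" using ij by (simp_all add: less_mult_imp_div_less)
  have mod: "i mod n < n" "j mod n < n" using n by simp_all
  have "q (j mod n) < n" using q mod permutes_less by blast
  then have "i = p (j div n) * n + q (j mod n) \<longleftrightarrow> i div n = p (j div n) \<and> i mod n = q (j mod n)"
    using n div_mult_mod_eq[of i n] by (metis div_mult_self3 add.right_neutral div_less mod_less mod_mult_self3 less_not_refl)
  then show ?case using ij div mod by (auto simp: kron_def perm_mat_def)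
qed (auto simp: kron_def)

section \<open>Kronecker products over index tuples\<close>

lemma finite_tuples [simp]: "finite S \<Longrightarrow> finite (tuples n S)"
  by (simp add: tuples_def finite_PiE)

lemma tuplesD: "t \<in> tuples n S \<Longrightarrow> j \<in> S \<Longrightarrow> t j < n j"
  by (auto simp: tuples_def PiE_def Pi_def)

lemma lex_tuple_in: "finite S \<Longrightarrow> a < prod n S \<Longrightarrow> lex_tuple n S a \<in> tuples n S"
  using lex_tuple_bij[of S n] by (auto simp: bij_betw_def)

lemma lex_tuple_less: "finite S \<Longrightarrow> a < prod n S \<Longrightarrow> j \<in> S \<Longrightarrow> lex_tuple n S a j < n j"
  using lex_tuple_in tuplesD by blast

lemma lex_tuple_obtain:
  assumes "finite S" "t \<in> tuples n S"
  obtains a where "a < prod n S" "lex_tuple n S a = t"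
  using lex_tuple_bij[OF assms(1), of n] assms(2) by (force simp: bij_betw_def)

lemma lex_tuple_cong: "(\<And>j. j \<in> S \<Longrightarrow> n j = m j) \<Longrightarrow> lex_tuple n S = lex_tuple m S"
  unfolding lex_tuple_def
  by (intro ext restrict_ext arg_cong2[where f = "(mod)"] arg_cong2[where f = "(div)"] prod.cong) auto

lemma sum_lex_tuple:
  "finite S \<Longrightarrow> (\<Sum>a<prod n S. f (lex_tuple n S a)) = (\<Sum>t\<in>tuples n S. f t)"
  by (rule sum.reindex_bij_betw[OF lex_tuple_bij])

lemma kron_family_eq:
  assumes "\<And>j. j \<in> S \<Longrightarrow> U j \<in> carrier_mat (n j) (r j)"
  shows "kron_family U S = mat (prod n S) (prod r S)
    (\<lambda>(a, b). \<Prod>j\<in>S. U j $$ (lex_tuple n S a j, lex_tuple r S b j))"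
proof -
  have "(\<Prod>j\<in>S. dim_row (U j)) = prod n S" "(\<Prod>j\<in>S. dim_col (U j)) = prod r S"
    using assms by (auto intro!: prod.cong)
  moreover have "lex_tuple (\<lambda>j. dim_row (U j)) S = lex_tuple n S"
    "lex_tuple (\<lambda>j. dim_col (U j)) S = lex_tuple r S"
    using assms by (auto intro!: lex_tuple_cong)
  ultimately show ?thesis by (simp add: kron_family_def)
qed

text \<open>Computed like a marginal of a product distribution: distributivity turns the sum over
  tuples into a product over modes, where every mode but \<open>j\<close> contributes 1. This
  isolates one factor of a Kronecker product.\<close>

lemma sum_tuples_marginal:
  fixes g :: "nat \<Rightarrow> nat \<Rightarrow> real"
  assumes S: "finite S" and g: "\<And>i. i \<in> S \<Longrightarrow> (\<Sum>y<n i. g i y) = 1" and j: "j \<in> S" "k < n j"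
  shows "(\<Sum>x\<in>tuples n S. of_bool (x j = k) * (\<Prod>i\<in>S. g i (x i))) = g j k"
proof -
  define h where "h i y = (if i = j then of_bool (y = k) else 1) * g i y" for i y
  have "(\<Sum>x\<in>tuples n S. of_bool (x j = k) * (\<Prod>i\<in>S. g i (x i))) = (\<Sum>x\<in>tuples n S. \<Prod>i\<in>S. h i (x i))"
  proof (rule sum.cong)
    fix x
    have "(\<Prod>i\<in>S. if i = j then of_bool (x i = k) else 1) = (of_bool (x j = k) :: real)"
      using S j by (simp add: prod.delta)
    then show "of_bool (x j = k) * (\<Prod>i\<in>S. g i (x i)) = (\<Prod>i\<in>S. h i (x i))"
      by (simp add: h_def prod.distrib)
  qed simp
  also have "\<dots> = (\<Prod>i\<in>S. \<Sum>y<n i. h i y)"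
    unfolding tuples_def using S by (subst prod_sum_PiE) auto
  also have "\<dots> = (\<Prod>i\<in>S. if i = j then g j k else 1)"
  proof (rule prod.cong)
    fix i assume i: "i \<in> S"
    have "(\<Sum>y<n j. of_bool (y = k) * g j y) = (\<Sum>y<n j. if y = k then g j y else 0)"
      by (rule sum.cong) auto
    then show "(\<Sum>y<n i. h i y) = (if i = j then g j k else 1)"
      using i g j by (simp add: h_def)
  qed simp
  also have "\<dots> = g j k" using S j by simp
  finally show ?thesis .
qed

lemma col_stochastic_kron_family:
  assumes S: "finite S" and U: "\<And>j. j \<in> S \<Longrightarrow> U j \<in> carrier_mat (n j) (r j) \<and> col_stochastic (U j)"
  shows "col_stochastic (kron_family U S)"
proof -
  have eq: "kron_family U S = mat (prod n S) (prod r S)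
    (\<lambda>(a, b). \<Prod>j\<in>S. U j $$ (lex_tuple n S a j, lex_tuple r S b j))"
    using U by (intro kron_family_eq) auto
  have "(\<Sum>a<prod n S. \<Prod>j\<in>S. U j $$ (lex_tuple n S a j, lex_tuple r S b j)) = 1"
    if b: "b < prod r S" for b
  proof -
    have "(\<Sum>a<prod n S. \<Prod>j\<in>S. U j $$ (lex_tuple n S a j, lex_tuple r S b j)) =
      (\<Sum>x\<in>tuples n S. \<Prod>j\<in>S. U j $$ (x j, lex_tuple r S b j))"
      by (rule sum_lex_tuple[OF S, of "\<lambda>x. \<Prod>j\<in>S. U j $$ (x j, lex_tuple r S b j)"])
    also have "\<dots> = (\<Prod>j\<in>S. \<Sum>y<n j. U j $$ (y, lex_tuple r S b j))"
      unfolding tuples_def using S by (subst prod_sum_PiE) auto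
    also have "\<dots> = 1"
      using U lex_tuple_less[OF S b] by (intro prod.neutral) (metis col_stochastic_iff)
    finally show ?thesis .
  qed
  then show ?thesis
    unfolding eq by (subst col_stochastic_iff[of _ "prod n S" "prod r S"]) auto
qed

text \<open>Summing both Kronecker products over all row modes but \<open>j\<close> identifies a column of \<open>U' j\<close> with a
  column of \<open>U j\<close>.  The columns of \<open>U j\<close> are distinct, so mode \<open>j\<close> of the permuted tuple depends only
  on mode \<open>j\<close> of the original one.\<close>

lemma kron_family_permutation_factors:
  assumes S: "finite S"
    and U: "\<And>j. j \<in> S \<Longrightarrow> U j \<in> carrier_mat (n j) (r j) \<and> col_stochastic (U j)"
    and U': "\<And>j. j \<in> S \<Longrightarrow> U' j \<in> carrier_mat (n j) (r j) \<and> col_stochastic (U' j)"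
    and r: "\<And>j. j \<in> S \<Longrightarrow> 0 < r j"
    and p: "p permutes {..<prod r S}"
    and eq: "kron_family U S * perm_mat (prod r S) p = kron_family U' S"
    and inj: "\<And>v. v \<in> carrier_vec (prod r S) \<Longrightarrow> kron_family U S *\<^sub>v v = 0\<^sub>v (prod n S)
      \<Longrightarrow> v = 0\<^sub>v (prod r S)"
  obtains s where "\<And>j. j \<in> S \<Longrightarrow> s j permutes {..<r j} \<and> U' j = U j * perm_mat (r j) (s j)"
    and "\<And>a. a < prod r S \<Longrightarrow> lex_tuple r S (p a) = (\<lambda>j\<in>S. s j (lex_tuple r S a j))"
proof -
  let ?t = "lex_tuple r S"
  have kU: "kron_family U S = mat (prod n S) (prod r S)
      (\<lambda>(a, b). \<Prod>j\<in>S. U j $$ (lex_tuple n S a j, ?t b j))"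
    and kU': "kron_family U' S = mat (prod n S) (prod r S)
      (\<lambda>(a, b). \<Prod>j\<in>S. U' j $$ (lex_tuple n S a j, ?t b j))"
    using U U' by (auto intro!: kron_family_eq)
  have cU: "kron_family U S \<in> carrier_mat (prod n S) (prod r S)" by (simp add: kU)
  note pl = permutes_less[OF p]
  have cols: "U' j $$ (k, ?t a j) = U j $$ (k, ?t (p a) j)"
    if a: "a < prod r S" and j: "j \<in> S" and k: "k < n j" for a j k
  proof -
    have "(\<Prod>i\<in>S. U' i $$ (x i, ?t a i)) = (\<Prod>i\<in>S. U i $$ (x i, ?t (p a) i))"
      if "x \<in> tuples n S" for x
    proof -
      obtain b where b: "b < prod n S" "lex_tuple n S b = x" using lex_tuple_obtain[OF S \<open>x \<in> tuples n S\<close>] .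
      have "kron_family U' S $$ (b, a) = kron_family U S $$ (b, p a)"
        unfolding eq[symmetric] using mult_perm_mat[OF cU b(1) a] pl[OF a] by simp
      then show ?thesis using a b pl[OF a] by (simp add: kU kU')
    qed
    then have "(\<Sum>x\<in>tuples n S. of_bool (x j = k) * (\<Prod>i\<in>S. U' i $$ (x i, ?t a i))) =
        (\<Sum>x\<in>tuples n S. of_bool (x j = k) * (\<Prod>i\<in>S. U i $$ (x i, ?t (p a) i)))"
      by simp
    also have "\<dots> = U j $$ (k, ?t (p a) j)"
      using U lex_tuple_less[OF S pl[OF a]] by (intro sum_tuples_marginal S j k) (metis col_stochastic_iff)
    also have "(\<Sum>x\<in>tuples n S. of_bool (x j = k) * (\<Prod>i\<in>S. U' i $$ (x i, ?t a i))) = U' j $$ (k, ?t a j)"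
      using U' lex_tuple_less[OF S a] by (intro sum_tuples_marginal S j k) (metis col_stochastic_iff)
    finally show ?thesis .
  qed
  \<comment> \<open>The other modes are filled with 0, a valid index because each \<open>r i\<close>
    is positive.\<close>
  have ex: "\<exists>a<prod r S. ?t a = (\<lambda>i\<in>S. if i = j then v else 0)" if "v < r j" for j v
  proof -
    have "(\<lambda>i\<in>S. if i = j then v else 0) \<in> tuples r S"
      using that r by (auto simp: tuples_def)
    then show ?thesis by (rule lex_tuple_obtain[OF S]) blast
  qed
  \<comment> \<open>Equal columns of \<open>U j\<close> would make two columns of the Kronecker
    product equal, and the difference of two unit vectors would lie in its kernel.\<close>
  have distinct: "u = v" if j: "j \<in> S" and uv: "u < r j" "v < r j"
    and same: "\<And>k. k < n j \<Longrightarrow> U j $$ (k, u) = U j $$ (k, v)" for j u v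
  proof (rule ccontr)
    assume "u \<noteq> v"
    obtain a where a: "a < prod r S" "?t a = (\<lambda>i\<in>S. if i = j then u else 0)" using ex[of u j] uv by blast
    obtain b where b: "b < prod r S" "?t b = (\<lambda>i\<in>S. if i = j then v else 0)" using ex[of v j] uv by blast
    have "?t a j = u" "?t b j = v" using a(2) b(2) j by simp_all
    then have "a \<noteq> b" using \<open>u \<noteq> v\<close> by blast
    let ?v = "unit_vec (prod r S) a - unit_vec (prod r S) b :: real vec"
    have "kron_family U S *\<^sub>v ?v = kron_family U S *\<^sub>v unit_vec (prod r S) a - kron_family U S *\<^sub>v unit_vec (prod r S) b"
      by (rule mult_minus_distrib_mat_vec[OF cU]) auto
    also have "\<dots> = 0\<^sub>v (prod n S)"
    proof (rule eq_vecI, goal_cases)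
      case (1 i)
      then have i: "i < prod n S" by simp
      have "(\<Prod>l\<in>S. U l $$ (lex_tuple n S i l, ?t a l)) = (\<Prod>l\<in>S. U l $$ (lex_tuple n S i l, ?t b l))"
        using a b same lex_tuple_less[OF S i] by (intro prod.cong) auto
      then show ?case using i a b cU by (simp add: kU)
    qed (use cU in auto)
    finally have "?v = 0\<^sub>v (prod r S)" by (intro inj) auto
    then have "?v $ a = 0" using a by simp
    then show False using a b \<open>a \<noteq> b\<close> by simp
  qed
  \<comment> \<open>Any tuple with value \<open>v\<close> in mode \<open>j\<close> serves, since
    \<open>cols\<close> and \<open>distinct\<close> make the result independent of the choice.
    Outside the range \<open>s j\<close> is the identity, as \<open>permutes\<close>
    demands.\<close>
  define s where "s j v = (if v < r j then ?t (p (SOME a. a < prod r S \<and> ?t a j = v)) j else v)" for j v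
  have s: "s j (?t a j) = ?t (p a) j" if a: "a < prod r S" and j: "j \<in> S" for a j
  proof -
    define b where "b = (SOME b. b < prod r S \<and> ?t b j = ?t a j)"
    have b: "b < prod r S" "?t b j = ?t a j"
      using someI[of "\<lambda>b. b < prod r S \<and> ?t b j = ?t a j" a] a by (simp_all add: b_def)
    have "?t (p b) j = ?t (p a) j"
      using cols[OF a j] cols[OF b(1) j] b(2) lex_tuple_less[OF S _ j] pl a b(1)
      by (intro distinct[OF j]) auto
    then show ?thesis using lex_tuple_less[OF S a j] by (simp add: s_def b_def)
  qed
  have ex': "\<exists>a<prod r S. ?t a j = v" if "j \<in> S" "v < r j" for j v
    using ex[of v j] that by auto
  show thesis
  proof (rule that)
    fix j assume j: "j \<in> S"
    have "s j ` {..<r j} = {..<r j}"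
    proof
      show "s j ` {..<r j} \<subseteq> {..<r j}"
      proof
        fix w assume "w \<in> s j ` {..<r j}"
        then obtain v where v: "v < r j" "w = s j v" by blast
        obtain a where a: "a < prod r S" "?t a j = v" using ex'[OF j v(1)] by blast
        show "w \<in> {..<r j}" using s[OF a(1) j] lex_tuple_less[OF S pl[OF a(1)] j] a(2) v(2) by simp
      qed
      show "{..<r j} \<subseteq> s j ` {..<r j}"
      proof
        fix v assume "v \<in> {..<r j}"
        then obtain b where b: "b < prod r S" "?t b j = v" using ex'[OF j] by auto
        have "b \<in> p ` {..<prod r S}" using b(1) permutes_image[OF p] by simp
        then obtain a where a: "a < prod r S" "p a = b" by blast
        then have "v = s j (?t a j)" using s[OF a(1) j] b(2) by simp
        then show "v \<in> s j ` {..<r j}" using lex_tuple_less[OF S a(1) j] by simp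
      qed
    qed
    then have "bij_betw (s j) {..<r j} {..<r j}"
      by (simp add: bij_betw_def eq_card_imp_inj_on)
    then have perm: "s j permutes {..<r j}"
      by (rule bij_imp_permutes) (simp add: s_def)
    moreover have "U' j = U j * perm_mat (r j) (s j)"
    proof (rule eq_matI, goal_cases)
      case (1 k v)
      then have k: "k < n j" and v: "v < r j" using U[OF j] by auto
      obtain a where a: "a < prod r S" "?t a j = v" using ex'[OF j v] by blast
      have "U' j $$ (k, v) = U j $$ (k, s j v)" using cols[OF a(1) j k] s[OF a(1) j] a(2) by simp
      then show ?case using mult_perm_mat[of "U j" "n j" "r j" k v "s j"] U[OF j] k v permutes_less[OF perm v] by simp
    qed (use U[OF j] U'[OF j] in auto)
    ultimately show "s j permutes {..<r j} \<and> U' j = U j * perm_mat (r j) (s j)" by blast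
  next
    fix a assume a: "a < prod r S"
    show "?t (p a) = (\<lambda>j\<in>S. s j (?t a j))"
    proof
      fix j
      show "?t (p a) j = (\<lambda>j\<in>S. s j (?t a j)) j"
        using s[OF a] by (cases "j \<in> S") (auto simp: lex_tuple_def)
    qed
  qed
qed

subsection \<open>Tensors and their slices\<close>

lemma restrict_tuples: "t \<in> tuples n S \<Longrightarrow> X \<subseteq> S \<Longrightarrow> restrict t X \<in> tuples n X"
  by (auto simp: tuples_def PiE_def Pi_def)

lemma join_tuples:
  assumes "x \<in> tuples n I" "y \<in> tuples n J" "z \<in> tuples n K"
  shows "join I J x y z \<in> tuples n (I \<union> J \<union> K)"
  using assms by (auto simp: tuples_def join_def PiE_def Pi_def extensional_def)

lemma join_restrict:
  assumes "t \<in> tuples n (I \<union> J \<union> K)"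
  shows "join I J (restrict t I) (restrict t J) (restrict t K) = t"
  using assms by (auto simp: tuples_def join_def PiE_def extensional_def fun_eq_iff)

lemma restrict_join:
  assumes "x \<in> tuples n I" "y \<in> tuples n J" "z \<in> tuples n K" "I \<inter> J = {}" "I \<inter> K = {}" "J \<inter> K = {}"
  shows "restrict (join I J x y z) I = x" "restrict (join I J x y z) J = y" "restrict (join I J x y z) K = z"
  using assms by (auto simp: tuples_def join_def PiE_def extensional_def fun_eq_iff)

lemma sum_tuples_join:
  assumes "I \<inter> J = {}" "I \<inter> K = {}" "J \<inter> K = {}"
  shows "(\<Sum>t\<in>tuples n (I \<union> J \<union> K). f t) =
    (\<Sum>x\<in>tuples n I. \<Sum>y\<in>tuples n J. \<Sum>z\<in>tuples n K. f (join I J x y z))"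
  unfolding sum.cartesian_product
  by (rule sum.reindex_bij_witness[of _ "\<lambda>(x, y, z). join I J x y z"
        "\<lambda>t. (restrict t I, restrict t J, restrict t K)"])
     (auto simp: restrict_join[where n = n] assms join_restrict[where n = n] join_tuples intro: restrict_tuples)

lemma prod_join:
  assumes "finite I" "finite J" "finite K" "I \<inter> J = {}" "I \<inter> K = {}" "J \<inter> K = {}"
  shows "(\<Prod>t\<in>I \<union> J \<union> K. h t (join I J x y z t)) =
    (\<Prod>t\<in>I. h t (x t)) * (\<Prod>t\<in>J. h t (y t)) * (\<Prod>t\<in>K. h t (z t))"
proof -
  have "(\<Prod>t\<in>I \<union> J \<union> K. h t (join I J x y z t)) = (\<Prod>t\<in>I. h t (join I J x y z t)) *
      (\<Prod>t\<in>J. h t (join I J x y z t)) * (\<Prod>t\<in>K. h t (join I J x y z t))"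
    using assms by (subst prod.union_disjoint, auto)+
  moreover have "(\<Prod>t\<in>I. h t (join I J x y z t)) = (\<Prod>t\<in>I. h t (x t))"
    "(\<Prod>t\<in>J. h t (join I J x y z t)) = (\<Prod>t\<in>J. h t (y t))"
    "(\<Prod>t\<in>K. h t (join I J x y z t)) = (\<Prod>t\<in>K. h t (z t))"
    using assms by (auto simp: join_def intro!: prod.cong)
  ultimately show ?thesis by simp
qed

section \<open>Slices and unfoldings as matrix products\<close>

lemma pair_index_less: "a < m \<Longrightarrow> b < n \<Longrightarrow> a * n + b < m * (n::nat)"
  using mult_le_mono1[of "Suc a" m n] by simp

lemma unfolding_mat_pair:
  assumes "p < prod r I" "q < prod r K" "s < prod r J"
  shows "unfolding_mat r I J K G $$ (p * prod r K + q, s) =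
    G (join I J (lex_tuple r I p) (lex_tuple r J s) (lex_tuple r K q))"
  using assms pair_index_less[OF assms(1,2)] by (simp add: unfolding_mat_def)

text \<open>The product of factor entries splits along \<open>I\<close>, \<open>J\<close> and
  \<open>K\<close>. Its \<open>J\<close>-part is row \<open>c\<close> of the Kronecker product over
  \<open>J\<close> and weights the columns of the unfolding; their sum, reshaped, is the core
  between the two outer factors.\<close>

lemma slice_factorization:
  assumes disj: "I \<inter> J = {}" "I \<inter> K = {}" "J \<inter> K = {}" and un: "I \<union> J \<union> K = {1..d}"
    and U: "\<And>i. i \<in> {1..d} \<Longrightarrow> U i \<in> carrier_mat (n i) (r i)"
    and c: "c < prod n J"
  shows "slice n I J K (multilinear_mult d U G) (lex_tuple n J c) =
    kron_family U I * mat (prod r I) (prod r K) (\<lambda>(p, q). \<Sum>s<prod r J.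
       unfolding_mat r I J K G $$ (p * prod r K + q, s) * kron_family U J $$ (c, s)) * (kron_family U K)\<^sup>T"
    (is "_ = ?A * ?X * ?C\<^sup>T")
proof (rule eq_matI, goal_cases)
  define D where "D = {1..d}"
  note un = un[folded D_def] and U = U[folded D_def] and mult_def = multilinear_mult_def[of d, folded D_def]
  have sub: "I \<subseteq> D" "J \<subseteq> D" "K \<subseteq> D" using un by auto
  have "finite D" by (simp add: D_def)
  then have fin: "finite I" "finite J" "finite K" using sub finite_subset by blast+
  have kr: "kron_family U X = mat (prod n X) (prod r X)
      (\<lambda>(a, b). \<Prod>j\<in>X. U j $$ (lex_tuple n X a j, lex_tuple r X b j))" if "X \<subseteq> D" for X
    using U that by (intro kron_family_eq) auto
  have dims: "?A \<in> carrier_mat (prod n I) (prod r I)" "?C \<in> carrier_mat (prod n K) (prod r K)"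
    by (simp_all add: kr sub)
  {
    case (1 a b)
    then have a: "a < prod n I" and b: "b < prod n K" using dims by auto
    let ?j = "join I J (lex_tuple n I a) (lex_tuple n J c) (lex_tuple n K b)"
    have tn: "tuples (\<lambda>t. dim_row (U t)) D = tuples n D"
      and tr: "tuples (\<lambda>t. dim_col (U t)) D = tuples r D"
      unfolding tuples_def using U by (auto intro!: PiE_cong simp: carrier_matD)
    have j: "?j \<in> tuples n D"
      unfolding un[symmetric] by (intro join_tuples lex_tuple_in fin a b c)
    have "slice n I J K (multilinear_mult d U G) (lex_tuple n J c) $$ (a, b) =
        (\<Sum>i\<in>tuples r D. (\<Prod>t\<in>D. U t $$ (?j t, i t)) * G i)"
      using a b j by (simp add: slice_def mult_def tn tr)
    also have "\<dots> = (\<Sum>x\<in>tuples r I. \<Sum>y\<in>tuples r J. \<Sum>z\<in>tuples r K.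
        (\<Prod>t\<in>I. U t $$ (lex_tuple n I a t, x t)) * (\<Prod>t\<in>J. U t $$ (lex_tuple n J c t, y t)) *
        (\<Prod>t\<in>K. U t $$ (lex_tuple n K b t, z t)) * G (join I J x y z))"
    proof -
      have "(\<Prod>t\<in>I \<union> J \<union> K. U t $$ (?j t, join I J x y z t)) =
          (\<Prod>t\<in>I. U t $$ (lex_tuple n I a t, x t)) * (\<Prod>t\<in>J. U t $$ (lex_tuple n J c t, y t)) *
          (\<Prod>t\<in>K. U t $$ (lex_tuple n K b t, z t))" for x y z
      proof -
        \<comment> \<open>Row and column tuple are both joins: \<open>prod_join\<close> resolves the
          row tuple, and the column tuple is then resolved within each group.\<close>
        have "(\<Prod>t\<in>I \<union> J \<union> K. U t $$ (?j t, join I J x y z t)) =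
          (\<Prod>t\<in>I. U t $$ (lex_tuple n I a t, join I J x y z t)) *
          (\<Prod>t\<in>J. U t $$ (lex_tuple n J c t, join I J x y z t)) *
          (\<Prod>t\<in>K. U t $$ (lex_tuple n K b t, join I J x y z t))"
          by (rule prod_join[OF fin disj, of "\<lambda>t l. U t $$ (l, join I J x y z t)"])
        moreover have "(\<Prod>t\<in>I. U t $$ (lex_tuple n I a t, join I J x y z t)) = (\<Prod>t\<in>I. U t $$ (lex_tuple n I a t, x t))"
          "(\<Prod>t\<in>J. U t $$ (lex_tuple n J c t, join I J x y z t)) = (\<Prod>t\<in>J. U t $$ (lex_tuple n J c t, y t))"
          "(\<Prod>t\<in>K. U t $$ (lex_tuple n K b t, join I J x y z t)) = (\<Prod>t\<in>K. U t $$ (lex_tuple n K b t, z t))"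
          using disj by (auto simp: join_def intro!: prod.cong)
        ultimately show ?thesis by simp
      qed
      then show ?thesis
        by (simp add: un[symmetric] sum_tuples_join[OF disj])
    qed
    also have "\<dots> = (\<Sum>p<prod r I. \<Sum>s<prod r J. \<Sum>q<prod r K.
        ?A $$ (a, p) * kron_family U J $$ (c, s) * ?C $$ (b, q) *
        unfolding_mat r I J K G $$ (p * prod r K + q, s))"
      unfolding sum_lex_tuple[OF fin(1), symmetric] sum_lex_tuple[OF fin(2), symmetric]
        sum_lex_tuple[OF fin(3), symmetric]
      by (intro sum.cong refl) (simp add: unfolding_mat_pair kr sub a b c)
    also have "\<dots> = (\<Sum>p<prod r I. \<Sum>q<prod r K. \<Sum>s<prod r J.
        ?A $$ (a, p) * (unfolding_mat r I J K G $$ (p * prod r K + q, s) * kron_family U J $$ (c, s)) * ?C $$ (b, q))"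
      by (rule sum.cong[OF refl], subst sum.swap) (simp add: mult_ac)
    also have "\<dots> = (\<Sum>p<prod r I. \<Sum>q<prod r K. ?A $$ (a, p) * ?X $$ (p, q) * ?C $$ (b, q))"
      by (intro sum.cong refl) (simp add: sum_distrib_left sum_distrib_right)
    also have "\<dots> = (\<Sum>q<prod r K. (\<Sum>p<prod r I. ?A $$ (a, p) * ?X $$ (p, q)) * ?C $$ (b, q))"
      by (subst sum.swap) (simp add: sum_distrib_right)
    also have "\<dots> = (\<Sum>q<prod r K. (?A * ?X) $$ (a, q) * ?C $$ (b, q))"
      using a dims by (intro sum.cong refl) (simp add: scalar_prod_def atLeast0LessThan)
    also have "\<dots> = (?A * ?X * ?C\<^sup>T) $$ (a, b)"
      using a b dims by (simp add: scalar_prod_def atLeast0LessThan del: index_mult_mat(1))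
         (simp add: index_mult_mat(1)[of a "?A * ?X" b] scalar_prod_def atLeast0LessThan)
    finally show ?case .
  }
  {
    case 2
    then show ?case using dims by (simp add: slice_def)
  next
    case 3
    then show ?case using dims by (simp add: slice_def)
  }
qed

text \<open>The product of entries is the indicator of a single tuple, so the sum collapses to one
  term.\<close>

lemma multilinear_mult_permutation:
  assumes s: "\<And>i. i \<in> {1..d} \<Longrightarrow> s i permutes {..<r i}" and t: "t \<in> tuples r {1..d}"
  shows "multilinear_mult d (\<lambda>i. (perm_mat (r i) (s i))\<^sup>T) G t = G (\<lambda>i\<in>{1..d}. s i (t i))"
proof -
  let ?u = "\<lambda>i\<in>{1..d}. s i (t i)"
  have u: "?u \<in> tuples r {1..d}"
    using permutes_less[OF s] tuplesD[OF t] by (auto simp: tuples_def)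
  have "multilinear_mult d (\<lambda>i. (perm_mat (r i) (s i))\<^sup>T) G t =
      (\<Sum>i\<in>tuples r {1..d}. (\<Prod>j=1..d. (perm_mat (r j) (s j))\<^sup>T $$ (t j, i j)) * G i)"
    using t by (simp add: multilinear_mult_def)
  also have "\<dots> = (\<Sum>i\<in>tuples r {1..d}. if i = ?u then G i else 0)"
  proof (rule sum.cong)
    fix i assume i: "i \<in> tuples r {1..d}"
    have "(\<Prod>j=1..d. (perm_mat (r j) (s j))\<^sup>T $$ (t j, i j)) = (\<Prod>j=1..d. of_bool (i j = s j (t j)))"
      using tuplesD[OF t] tuplesD[OF i] by (intro prod.cong) (auto simp: perm_mat_def)
    also have "\<dots> = of_bool (\<forall>j\<in>{1..d}. i j = s j (t j))"
      by (induction d) (auto simp: atLeastAtMostSuc_conv)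
    also have "(\<forall>j\<in>{1..d}. i j = s j (t j)) \<longleftrightarrow> i = ?u"
      using i by (auto simp: tuples_def PiE_def extensional_def fun_eq_iff)
    finally show "(\<Prod>j=1..d. (perm_mat (r j) (s j))\<^sup>T $$ (t j, i j)) * G i = (if i = ?u then G i else 0)"
      by simp
  qed simp
  also have "\<dots> = G ?u" using u by simp
  finally show ?thesis .
qed

text \<open>The pseudoinverses are left inverses of the permuted factors. Inserting a permutation
  matrix times its transpose beside each true factor leaves the core with permuted rows and
  columns.\<close>

lemma mp_inverse_sandwich:
  assumes A: "A \<in> carrier_mat m r" "\<And>v. v \<in> carrier_vec r \<Longrightarrow> A *\<^sub>v v = 0\<^sub>v m \<Longrightarrow> v = 0\<^sub>v r"
    and C: "C \<in> carrier_mat k r" "\<And>v. v \<in> carrier_vec r \<Longrightarrow> C *\<^sub>v v = 0\<^sub>v k \<Longrightarrow> v = 0\<^sub>v r"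
    and X: "X \<in> carrier_mat r r" and p: "p permutes {..<r}" and q: "q permutes {..<r}"
  shows "mp_inverse (A * perm_mat r p) * (A * X * C\<^sup>T) * mp_inverse ((C * perm_mat r q)\<^sup>T) =
    (perm_mat r p)\<^sup>T * X * perm_mat r q"
proof -
  have inj: "v = 0\<^sub>v r" if "\<And>v. v \<in> carrier_vec r \<Longrightarrow> H *\<^sub>v v = 0\<^sub>v l \<Longrightarrow> v = 0\<^sub>v r"
    "H \<in> carrier_mat l r" "p permutes {..<r}" "v \<in> carrier_vec r" "(H * perm_mat r p) *\<^sub>v v = 0\<^sub>v l" for H l p v
  proof -
    have "perm_mat r p *\<^sub>v v = 0\<^sub>v r"
      using that by (intro that(1) mult_mat_vec_carrier[of _ r r])
        (auto simp: assoc_mult_mat_vec[of H l r "perm_mat r p" r])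
    moreover have "(perm_mat r p)\<^sup>T *\<^sub>v 0\<^sub>v r = 0\<^sub>v r" by (intro eq_vecI) auto
    ultimately have "(perm_mat r p)\<^sup>T *\<^sub>v (perm_mat r p *\<^sub>v v) = 0\<^sub>v r" by simp
    then show ?thesis
      using that(4) perm_mat_orthogonal(1)[OF that(3)]
      by (simp add: assoc_mult_mat_vec[of _ r r _ r, symmetric])
  qed
  let ?P = "perm_mat r p" and ?Q = "perm_mat r q"
  have AP: "A * ?P \<in> carrier_mat m r" and CQ: "C * ?Q \<in> carrier_mat k r"
    using A(1) C(1) by (auto intro: mult_carrier_mat)
  define L R where "L = mp_inverse (A * ?P)" and "R = mp_inverse (C * ?Q)"
  have L: "L \<in> carrier_mat r m" "L * (A * ?P) = 1\<^sub>m r"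
    unfolding L_def by (rule mp_inverse_full_column_rank[OF AP inj[OF A(2,1) p]]; assumption)+
  have R: "R \<in> carrier_mat r k" "R * (C * ?Q) = 1\<^sub>m r" "mp_inverse ((C * ?Q)\<^sup>T) = R\<^sup>T"
    unfolding R_def by (rule mp_inverse_full_column_rank[OF CQ inj[OF C(2,1) q]]; assumption)+
  have "A * ?P * ?P\<^sup>T = A" using A(1) perm_mat_orthogonal(2)[OF p] by (simp add: mat_assoc)
  moreover have "C * ?Q * ?Q\<^sup>T = C" using C(1) perm_mat_orthogonal(2)[OF q] by (simp add: mat_assoc)
  ultimately have "L * (A * X * C\<^sup>T) * mp_inverse ((C * ?Q)\<^sup>T) =
      L * ((A * ?P * ?P\<^sup>T) * X * (C * ?Q * ?Q\<^sup>T)\<^sup>T) * R\<^sup>T"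
    by (simp only: R(3))
  also have "\<dots> = (L * (A * ?P)) * (?P\<^sup>T * X * ?Q) * (R * (C * ?Q))\<^sup>T"
    using A(1) C(1) X L(1) R(1) by (simp add: mat_assoc mat_transpose_mult)
  also have "\<dots> = ?P\<^sup>T * X * ?Q" using X L(2) R(2) by simp
  finally show ?thesis unfolding L_def .
qed

lemma pair_div_mod: "b < (n::nat) \<Longrightarrow> (a * n + b) div n = a" "b < n \<Longrightarrow> (a * n + b) mod n = b"
  by simp_all

lemma pair_cases:
  assumes "x < m * (n::nat)"
  obtains a b where "a < m" "b < n" "x = a * n + b"
proof -
  have "0 < n" using assms by (auto intro: gr0I)
  then show thesis
    using that[of "x div n" "x mod n"] assms by (simp add: less_mult_imp_div_less)
qed

lemma permutes_obtain:
  assumes "p permutes {..<n}" "i < (n::nat)"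
  obtains j where "j < n" "p j = i"
proof -
  have "i \<in> p ` {..<n}" using assms permutes_image[OF assms(1)] by simp
  then show thesis using that by blast
qed

lemma kron_perm_transpose_mult:
  assumes p: "p permutes {..<m}" and q: "q permutes {..<n}" and X: "X \<in> carrier_mat (m * n) k"
    and a: "a < m" and b: "b < n" and s: "s < k"
  shows "((kron (perm_mat m p) (perm_mat n q))\<^sup>T * X) $$ (a * n + b, s) = X $$ (p a * n + q b, s)"
  unfolding kron_perm_mat[OF q]
  using X s pair_index_less[OF a b] pair_index_less[OF permutes_less[OF p a] permutes_less[OF q b]]
  by (subst transpose_perm_mat_mult[of X "m * n" k]) (simp_all add: pair_div_mod b)

section \<open>Assembly of all modes and the core tensor\<close>

theorem theorem6p13:
  fixes d :: nat and n r :: "nat \<Rightarrow> nat" and I J K :: "nat set" and R :: nat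
    and T G G' :: "(nat \<Rightarrow> nat) \<Rightarrow> real"
    and U U' :: "nat \<Rightarrow> real mat"
    and i0 :: "nat \<Rightarrow> nat"
    and UI UJ UK S1 S Gm PI PJ PK :: "real mat"
  assumes "T \<in> tensors d n" and "G \<in> tensors d r"
    and "\<forall>i\<in>{1..d}. U i \<in> carrier_mat (n i) (r i) \<and> nonneg_mat (U i) \<and> col_stochastic (U i)"
    and "T = multilinear_mult d U G"
    and "I \<union> J \<union> K = {1..d}" and "I \<inter> J = {}" and "I \<inter> K = {}" and "J \<inter> K = {}"
    and "I \<noteq> {}" and "J \<noteq> {}" and "K \<noteq> {}"
    (* (i) *)
    and "\<forall>X\<in>{I, J, K}. SSC (kron_family U X)"
    (* (ii) *)
    and "i0 \<in> tuples n J"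
    and "mat_rank (slice n I J K T i0) = prod r I" and "prod r I = prod r K" and "prod r K = R"
    (* (iii) *)
    and "mat_rank (unfolding_mat r I J K G) = prod r J" and "prod r J \<le> R\<^sup>2"
    (* step 1 *)
    and "tri_optimal (slice n I J K T i0) R (UI, UK, S1)"
    (* step 2 *)
    and "S \<in> carrier_mat (R\<^sup>2) (prod n J)"
    and "\<forall>a<prod n J. col S a =
           vec_of_mat (mp_inverse UI * slice n I J K T (lex_tuple n J a) * mp_inverse (UK\<^sup>T))"
    and "bi_optimal S (prod r J) (Gm, UJ)"
    (* step 3 *)
    and "\<forall>j\<in>{1..d}. U' j \<in> carrier_mat (n j) (r j) \<and> col_stochastic (U' j)"
    and "permutation_mat (prod r I) PI" and "UI * PI = kron_family U' I"
    and "permutation_mat (prod r J) PJ" and "UJ * PJ = kron_family U' J"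
    and "permutation_mat (prod r K) PK" and "UK * PK = kron_family U' K"
    (* step 4 *)
    and "G' \<in> tensors d r"
    and "unfolding_mat r I J K G' = (kron PI PK)\<^sup>T * Gm * PJ"
  shows "\<exists>P :: nat \<Rightarrow> real mat.
           (\<forall>i\<in>{1..d}. permutation_mat (r i) (P i) \<and> U' i = U i * P i) \<and>
           G' = multilinear_mult d (\<lambda>i. (P i)\<^sup>T) G"
proof -
  note T = assms(4) and un = assms(5) and disj = assms(6-8)
  define D where "D = {1..d}"
  note U = assms(3)[folded D_def, rule_format] and U' = assms(23)[folded D_def, rule_format]
  note unD = un[folded D_def]
  have sub: "I \<subseteq> D" "J \<subseteq> D" "K \<subseteq> D" using unD by auto
  have "finite D" by (simp add: D_def)
  then have fin: "finite I" "finite J" "finite K" using sub finite_subset by blast+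
  define A B C where "A = kron_family U I" and "B = kron_family U J" and "C = kron_family U K"
  have SSC: "SSC A" "SSC B" "SSC C" using assms(12) by (auto simp: A_def B_def C_def)
  have rI: "prod r I = R" and rK: "prod r K = R" using assms(15,16) by auto
  have cf: "kron_family U X \<in> carrier_mat (prod n X) (prod r X)" if "X \<subseteq> D" for X
    using U that by (subst kron_family_eq[of X U n r]) auto
  have A: "A \<in> carrier_mat (prod n I) R" and B: "B \<in> carrier_mat (prod n J) (prod r J)"
    and C: "C \<in> carrier_mat (prod n K) R"
    using cf[OF sub(1)] cf[OF sub(2)] cf[OF sub(3)] by (simp_all add: A_def B_def C_def rI rK)
  have stoch: "col_stochastic A" "col_stochastic B" "col_stochastic C"
    unfolding A_def B_def C_def
    using U sub fin by (auto intro!: col_stochastic_kron_family[where n = n and r = r])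
  \<comment> \<open>The SSC demands at least two columns, so no \<open>r j\<close> is 0.\<close>
  have "prod r X \<noteq> 0" if "X \<in> {I, J, K}" for X
  proof -
    have "X \<subseteq> D" "SSC (kron_family U X)" using that sub assms(12) by blast+
    then show ?thesis using carrier_matD(2)[OF cf] by (simp add: SSC_def)
  qed
  then have "prod r I \<noteq> 0" "prod r J \<noteq> 0" "prod r K \<noteq> 0" by blast+
  then have rpos: "0 < r j" if "j \<in> D" for j
    using that unD fin by (metis Un_iff gr0I prod_zero_iff)
  define GJ where "GJ = unfolding_mat r I J K G"
  have GJ: "GJ \<in> carrier_mat (R * R) (prod r J)" by (simp add: GJ_def unfolding_mat_def rI rK)
  have GJinj: "v = 0\<^sub>v (prod r J)" if "v \<in> carrier_vec (prod r J)" "GJ *\<^sub>v v = 0\<^sub>v (R * R)" for v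
    using mat_rank_full_inj[OF GJ] that assms(17) by (simp add: GJ_def)
  \<comment> \<open>Core of slice \<open>c\<close>: the columns of the unfolding weighted by row
    \<open>c\<close> of \<open>B\<close> and reshaped to a square matrix.\<close>
  define X where "X c = mat R R (\<lambda>(p, q). \<Sum>s<prod r J. GJ $$ (p * R + q, s) * B $$ (c, s))" for c
  have X: "X c \<in> carrier_mat R R" for c by (simp add: X_def)
  have slice: "slice n I J K T (lex_tuple n J c) = A * X c * C\<^sup>T" if "c < prod n J" for c
    unfolding T A_def X_def C_def B_def GJ_def
    using slice_factorization[OF disj un _ that, of U r G] U by (simp add: rI rK D_def)

  obtain c0 where c0: "c0 < prod n J" "lex_tuple n J c0 = i0"
    using lex_tuple_obtain[OF fin(2) assms(13)] .
  have M: "slice n I J K T i0 = A * X c0 * C\<^sup>T" using slice[OF c0(1)] c0(2) by simp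
  \<comment> \<open>The rank of the slice passes to \<open>A * X c0\<close>, and a kernel vector of
    \<open>X c0\<close> would also be one of this product.\<close>
  have "mat_rank (A * X c0 * C\<^sup>T) = R" using M assms(14) rI by simp
  then have rk: "mat_rank (A * X c0) = R"
    using C by (intro mat_rank_mult_full[OF mult_carrier_mat[OF A X], of "C\<^sup>T" "prod n K"]) auto
  have "det (X c0) \<noteq> 0"
  proof
    assume "det (X c0) = 0"
    then obtain v where v: "v \<in> carrier_vec R" "v \<noteq> 0\<^sub>v R" "X c0 *\<^sub>v v = 0\<^sub>v R"
      using det_0_iff_vec_prod_zero[OF X] by blast
    moreover have "A *\<^sub>v 0\<^sub>v R = 0\<^sub>v (prod n I)" using A by (intro eq_vecI) auto
    ultimately have "(A * X c0) *\<^sub>v v = 0\<^sub>v (prod n I)"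
      using assoc_mult_mat_vec[OF A X v(1), of c0] by simp
    then show False
      using mat_rank_full_inj[OF mult_carrier_mat[OF A X] rk v(1)] v(2) by blast
  qed
  then obtain P Q where "permutation_mat R P" "permutation_mat R Q" and UIK: "UI = A * P" "UK = C * Q"
    using tri_recover[OF A SSC(1) stoch(1) C SSC(3) stoch(3) X _ M assms(19)] by blast
  then obtain f h where f: "f permutes {..<R}" "P = perm_mat R f" and h: "h permutes {..<R}" "Q = perm_mat R h"
    unfolding permutation_mat_iff by blast

  \<comment> \<open>The left factor that step 2 has to recover: the unfolding with its rows permuted
    by the solution of step 1.\<close>
  define F where "F = (kron P Q)\<^sup>T * GJ"
  have dimkron: "kron (perm_mat R f') (perm_mat R h') \<in> carrier_mat (R * R) (R * R)" for f' h'
    by (simp add: kron_def)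
  have F: "F \<in> carrier_mat (R * R) (prod r J)"
    using GJ dimkron[of f h] by (simp add: F_def f h)
  have Fi: "F $$ (a * R + b, s) = GJ $$ (f a * R + h b, s)" if "a < R" "b < R" "s < prod r J" for a b s
    unfolding F_def f(2) h(2) by (rule kron_perm_transpose_mult[OF f(1) h(1) GJ that])
  \<comment> \<open>The rows of \<open>F\<close> are those of \<open>GJ\<close> rearranged, so each
    entry of \<open>GJ *\<^sub>v v\<close> is an entry of \<open>F *\<^sub>v v\<close>.\<close>
  have Finj: "v = 0\<^sub>v (prod r J)" if v: "v \<in> carrier_vec (prod r J)" and Fv: "F *\<^sub>v v = 0\<^sub>v (R * R)" for v
  proof (rule GJinj[OF v], rule eq_vecI, goal_cases)
    case (1 i)
    then have "i < R * R" by simp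
    then obtain a b where ab: "a < R" "b < R" "i = a * R + b" by (rule pair_cases)
    obtain a' where a': "a' < R" "f a' = a" using permutes_obtain[OF f(1) ab(1)] .
    obtain b' where b': "b' < R" "h b' = b" using permutes_obtain[OF h(1) ab(2)] .
    note ab' = a' b'
    have x: "a' * R + b' < R * R" by (rule pair_index_less[OF ab'(1,3)])
    have "(GJ *\<^sub>v v) $ i = (\<Sum>s = 0..<prod r J. GJ $$ (i, s) * v $ s)"
      using GJ v \<open>i < R * R\<close> by (simp add: scalar_prod_def)
    also have "\<dots> = (\<Sum>s = 0..<prod r J. F $$ (a' * R + b', s) * v $ s)"
      using Fi[OF ab'(1,3)] ab ab' by (intro sum.cong) auto
    also have "\<dots> = (F *\<^sub>v v) $ (a' * R + b')"
      using F v x by (simp add: scalar_prod_def)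
    finally show ?case using Fv x \<open>i < R * R\<close> by simp
  qed (use GJ in auto)
  \<comment> \<open>Column \<open>c\<close> of \<open>S\<close> vectorises the permuted core, so its
    entry at \<open>a * R + b\<close> is entry \<open>(f a, h b)\<close> of \<open>X c\<close>: row
    \<open>a * R + b\<close> of \<open>F\<close> against row \<open>c\<close> of
    \<open>B\<close>.\<close>
  have S: "S = F * B\<^sup>T"
  proof (rule eq_matI, goal_cases)
    case (1 x c)
    then have x: "x < R * R" and c: "c < prod n J" using F B by auto
    from x obtain a b where ab: "a < R" "b < R" "x = a * R + b" by (rule pair_cases)
    define W where "W = P\<^sup>T * X c * Q"
    have W: "W \<in> carrier_mat R R" 
      unfolding W_def f(2) h(2) using X[of c] by (intro mult_carrier_mat[of _ R R]) auto
    have "mp_inverse UI * slice n I J K T (lex_tuple n J c) * mp_inverse (UK\<^sup>T) = W"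
      unfolding UIK slice[OF c] W_def f(2) h(2)
      by (rule mp_inverse_sandwich[OF A SSC_inj[OF A SSC(1)] C SSC_inj[OF C SSC(3)] X f(1) h(1)])
    then have "col S c = vec_of_mat W" using assms(21) c by simp
    then have "S $$ (x, c) = vec_of_mat W $ x"
      using assms(20) c \<open>x < R * R\<close> by (metis carrier_matD index_col power2_eq_square)
    also have "\<dots> = W $$ (a, b)"
      using W \<open>x < R * R\<close> ab by (simp add: vec_of_mat_def pair_div_mod)
    also have "\<dots> = (P\<^sup>T * X c) $$ (a, h b)"
      unfolding W_def f(2) h(2) using ab permutes_less[OF h(1)]
      by (intro mult_perm_mat[OF mult_carrier_mat[OF _ X]]) auto
    also have "\<dots> = X c $$ (f a, h b)"
      unfolding f(2) using ab permutes_less[OF h(1)] permutes_less[OF f(1)]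
      by (intro transpose_perm_mat_mult[OF X]) auto
    also have "\<dots> = (\<Sum>s<prod r J. F $$ (x, s) * B $$ (c, s))"
      using ab permutes_less[OF h(1)] permutes_less[OF f(1)] by (simp add: X_def Fi)
    also have "\<dots> = (F * B\<^sup>T) $$ (x, c)"
      using F B c \<open>x < R * R\<close> by (simp add: scalar_prod_def atLeast0LessThan)
    finally show ?case .
  qed (use assms(20) F B in \<open>auto simp: power2_eq_square\<close>)

  obtain L where "permutation_mat (prod r J) L" and UJ: "UJ = B * L" and FL: "F = Gm * L\<^sup>T"
    using bi_recover[OF B SSC(2) stoch(2) F Finj S assms(22)] by blast
  then obtain l where l: "l permutes {..<prod r J}" "L = perm_mat (prod r J) l"
    unfolding permutation_mat_iff by blast
  have "bi_feasible S (prod r J) (Gm, UJ)"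
    using assms(22) by (simp add: bi_optimal_def is_arg_min_linorder)
  then have Gm: "Gm \<in> carrier_mat (R * R) (prod r J)"
    using assms(20) by (simp add: bi_feasible_def power2_eq_square)
  have FL': "Gm = F * L"
    unfolding FL l(2) using Gm perm_mat_orthogonal(1)[OF l(1)] by (simp add: mat_assoc)

  obtain pI pJ pK where p: "pI permutes {..<R}" "PI = perm_mat R pI"
    "pJ permutes {..<prod r J}" "PJ = perm_mat (prod r J) pJ" "pK permutes {..<R}" "PK = perm_mat R pK"
    using assms(24,26,28) unfolding permutation_mat_iff rI rK by blast
  \<comment> \<open>Stated once for all three groups: \<open>g\<close> is the permutation from the
    optimisation and \<open>p\<close> the one from step 3.\<close>
  have factors: "\<exists>s. (\<forall>j\<in>X. s j permutes {..<r j} \<and> U' j = U j * perm_mat (r j) (s j)) \<and>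
      (\<forall>a<prod r X. lex_tuple r X (g (p a)) = (\<lambda>j\<in>X. s j (lex_tuple r X a j)))"
    if "X \<in> {I, J, K}" and g: "g permutes {..<prod r X}" and p: "p permutes {..<prod r X}"
      and eq: "kron_family U X * perm_mat (prod r X) g * perm_mat (prod r X) p = kron_family U' X"
    for X g p
  proof -
    have X: "finite X" "X \<subseteq> D" "SSC (kron_family U X)" using that fin sub assms(12) by auto
    have UX: "U j \<in> carrier_mat (n j) (r j) \<and> col_stochastic (U j)"
      "U' j \<in> carrier_mat (n j) (r j) \<and> col_stochastic (U' j)" "0 < r j" if "j \<in> X" for j
      using U U' rpos X(2) that by blast+
    have "kron_family U X * perm_mat (prod r X) (g \<circ> p) =
        kron_family U X * perm_mat (prod r X) g * perm_mat (prod r X) p"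
      unfolding perm_mat_comp[OF p, symmetric]
      by (rule assoc_mult_mat[symmetric, OF cf[OF X(2)] perm_mat_carrier perm_mat_carrier])
    then have "kron_family U X * perm_mat (prod r X) (g \<circ> p) = kron_family U' X"
      using eq by (rule trans)
    note eq' = this
    show ?thesis
    proof (rule kron_family_permutation_factors[OF X(1) UX permutes_compose[OF p g] eq'
          SSC_inj[OF cf[OF X(2)] X(3)]], assumption+)
      fix s
      assume "\<And>j. j \<in> X \<Longrightarrow> s j permutes {..<r j} \<and> U' j = U j * perm_mat (r j) (s j)"
        and "\<And>a. a < prod r X \<Longrightarrow> lex_tuple r X ((g \<circ> p) a) = (\<lambda>j\<in>X. s j (lex_tuple r X a j))"
      then show ?thesis by (intro exI[of _ s]) simp
    qed
  qed
  have "I \<in> {I, J, K}" "J \<in> {I, J, K}" "K \<in> {I, J, K}" by simp_all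
  note factors = factors[OF this(1), unfolded rI] factors[OF this(2)] factors[OF this(3), unfolded rK]
  obtain sI where "(\<forall>j\<in>I. sI j permutes {..<r j} \<and> U' j = U j * perm_mat (r j) (sI j)) \<and>
      (\<forall>a<R. lex_tuple r I (f (pI a)) = (\<lambda>j\<in>I. sI j (lex_tuple r I a j)))"
    using factors(1)[OF f(1) p(1) assms(25)[unfolded UIK A_def f(2) p(2)]] ..
  note sI = this[THEN conjunct1, rule_format] this[THEN conjunct2, rule_format]
  obtain sJ where "(\<forall>j\<in>J. sJ j permutes {..<r j} \<and> U' j = U j * perm_mat (r j) (sJ j)) \<and>
      (\<forall>a<prod r J. lex_tuple r J (l (pJ a)) = (\<lambda>j\<in>J. sJ j (lex_tuple r J a j)))"
    using factors(2)[OF l(1) p(3) assms(27)[unfolded UJ B_def l(2) p(4)]] ..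
  note sJ = this[THEN conjunct1, rule_format] this[THEN conjunct2, rule_format]
  obtain sK where "(\<forall>j\<in>K. sK j permutes {..<r j} \<and> U' j = U j * perm_mat (r j) (sK j)) \<and>
      (\<forall>a<R. lex_tuple r K (h (pK a)) = (\<lambda>j\<in>K. sK j (lex_tuple r K a j)))"
    using factors(3)[OF h(1) p(5) assms(29)[unfolded UIK C_def h(2) p(6)]] ..
  note sK = this[THEN conjunct1, rule_format] this[THEN conjunct2, rule_format]
  define s where "s j = (if j \<in> I then sI j else if j \<in> J then sJ j else sK j)" for j
  have s: "s j permutes {..<r j} \<and> U' j = U j * perm_mat (r j) (s j)" if "j \<in> D" for j
    using that unD sI(1) sJ(1) sK(1) by (auto simp: s_def)

  \<comment> \<open>An entry of \<open>G'\<close> is traced back through steps 4, 2 and 1. In each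
    group the two position permutations met on the way compose to the one that
    \<open>factors\<close> splits.\<close>
  have entry: "G' t = G (\<lambda>j\<in>D. s j (t j))" if t: "t \<in> tuples r D" for t
  proof -
    obtain a where a: "a < R" "lex_tuple r I a = restrict t I"
      using lex_tuple_obtain[OF fin(1) restrict_tuples[OF t sub(1)], unfolded rI] .
    obtain b where b: "b < prod r J" "lex_tuple r J b = restrict t J"
      using lex_tuple_obtain[OF fin(2) restrict_tuples[OF t sub(2)]] .
    obtain c where c: "c < R" "lex_tuple r K c = restrict t K"
      using lex_tuple_obtain[OF fin(3) restrict_tuples[OF t sub(3)], unfolded rK] .
    note less = permutes_less[OF p(1) a(1)] permutes_less[OF p(3) b(1)] permutes_less[OF p(5) c(1)]
    note less' = permutes_less[OF f(1) less(1)] permutes_less[OF l(1) less(2)] permutes_less[OF h(1) less(3)]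
    have KG: "(kron PI PK)\<^sup>T * Gm \<in> carrier_mat (R * R) (prod r J)"
      using dimkron[of pI pK] p by (intro mult_carrier_mat[OF _ Gm]) simp
    have "G' t = unfolding_mat r I J K G' $$ (a * R + c, b)"
      using unfolding_mat_pair[of a r I c K b J G'] a b c join_restrict[of t r I J K] t unD
      by (simp add: rI rK)
    also have "\<dots> = ((kron PI PK)\<^sup>T * Gm) $$ (a * R + c, pJ b)"
      unfolding assms(31) p(4) by (intro mult_perm_mat[OF KG] pair_index_less a(1) c(1) b(1) less)
    also have "\<dots> = Gm $$ (pI a * R + pK c, pJ b)"
      unfolding p(2,6) by (rule kron_perm_transpose_mult[OF p(1,5) Gm a(1) c(1) less(2)])
    also have "\<dots> = F $$ (pI a * R + pK c, l (pJ b))"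
      unfolding FL' l(2) by (intro mult_perm_mat[OF F] pair_index_less less less')
    also have "\<dots> = GJ $$ (f (pI a) * R + h (pK c), l (pJ b))"
      by (rule Fi[OF less(1,3) less'(2)])
    also have "\<dots> = G (join I J (lex_tuple r I (f (pI a))) (lex_tuple r J (l (pJ b))) (lex_tuple r K (h (pK c))))"
      using unfolding_mat_pair[of "f (pI a)" r I "h (pK c)" K "l (pJ b)" J G] less'
      by (simp add: GJ_def rI rK)
    also have "join I J (lex_tuple r I (f (pI a))) (lex_tuple r J (l (pJ b))) (lex_tuple r K (h (pK c))) =
        (\<lambda>j\<in>D. s j (t j))"
      unfolding sI(2)[OF a(1)] sJ(2)[OF b(1)] sK(2)[OF c(1)] a(2) b(2) c(2)
      using unD disj by (auto simp: join_def s_def fun_eq_iff)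
    finally show ?thesis .
  qed
  let ?P = "\<lambda>i. perm_mat (r i) (s i)"
  have "G' = multilinear_mult d (\<lambda>i. (?P i)\<^sup>T) G"
  proof
    fix t
    show "G' t = multilinear_mult d (\<lambda>i. (?P i)\<^sup>T) G t"
    proof (cases "t \<in> tuples r D")
      case True
      then show ?thesis
        using entry multilinear_mult_permutation[of d s r t G] s by (simp add: D_def)
    next
      \<comment> \<open>Outside the index tuples both tensors take the default value
        \<open>undefined\<close>.\<close>
      case False
      then show ?thesis
        using assms(30) by (auto simp: D_def tensors_def PiE_def extensional_def multilinear_mult_def)
    qed
  qed
  moreover have "\<forall>i\<in>{1..d}. permutation_mat (r i) (?P i) \<and> U' i = U i * ?P i"
    unfolding D_def[symmetric] permutation_mat_iff using s by blast
  ultimately show ?thesis by (intro exI[of _ ?P]) blast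
qed

end
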